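(* Let $\bar{\mathbf X}=(X,\mathbb X,\mathbb X(-r))\in\bar{\mathcal C}^\alpha(I,\mathbb R^d)$ with $I=[0,T]$, $\alpha\in(\frac13,\frac12]$, $r>0$. For $i=1,\dots,d$ let $(y^i,y^{i,\prime},\bar y^{i,\prime})\in\mathcal D^{2\alpha}_{\bar{\mathbf X},\theta}(I)$ be delayed controlled paths based on $\bar{\mathbf X}$, $\theta\in\mathbb R$. Write $y^{i,j,\prime}$ and $\bar y^{i,j,\prime}$ for the $j$-th components of $y^{i,\prime}$ and $\bar y^{i,\prime}$, and $y\cdot\delta X=\sum_iy^i\delta X^i$, $y':\mathbb X=\sum_{i,j}y^{i,j,\prime}\mathbb X^{j,i}$, $\bar y':\mathbb X(-r)=\sum_{i,j}\bar y^{i,j,\prime}\mathbb X(-r)^{j,i}$. Then: (i) For $t\in[0,T]$ the rough convolution $$\int_0^tS_{t,s}y_s\cdot\mathrm d\bar{\mathbf X}_s:=\lim_{|\mathcal P|\to0}\sum_{[u,v]\in\mathcal P}S_{t,u}\big[y_u\cdot\delta X_{v,u}+y'_u:\mathbb X_{v,u}+\bar y'_u:\mathbb X(-r)_{v,u}\big]$$ (limit along partitions $\mathcal P$ of $[0,t]$ with mesh $|\mathcal P|\to0$) exists and belongs to $\mathcal B_{\theta-2\alpha}$. (ii) For $0\le\beta<3\alpha$ and $0\le s\le t\le T$, $$\Big\|\int_s^tS_{t,u}y_u\cdot\mathrm d\bar{\mathbf X}_u-S_{t,s}\big[y_s\cdot\delta X_{t,s}+y'_s:\mathbb X_{t,s}+\bar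 y'_s:\mathbb X(-r)_{t,s}\big]\Big\|_{\theta-2\alpha+\beta}\lesssim\|y\cdot\delta X+y':\mathbb X+\bar y':\mathbb X(-r)\|_{\mathcal J^\alpha_\theta}(t-s)^{3\alpha-\beta}\lesssim\rho_{\alpha,I}(\bar{\mathbf X})\,\|y,y',\bar y'\|_{\bar{\mathbf X},2\alpha,\theta}\,(t-s)^{3\alpha-\beta}.$$
   Context: **Spaces and semigroup.** $(\mathcal B_\theta)_{\theta\in\mathbb R}$ is a monotone family of interpolation spaces: separable Banach spaces with norms $\|\cdot\|_\theta$, $\mathcal B_{\theta_2}$ densely and continuously embedded in $\mathcal B_{\theta_1}$ if $\theta_1\le\theta_2$, and $\|x\|_{\theta_2}^{\theta_3-\theta_1}\le C\|x\|_{\theta_1}^{\theta_3-\theta_2}\|x\|_{\theta_3}^{\theta_2-\theta_1}$ for $\theta_1\le\theta_2\le\theta_3$, $x\in\mathcal B_{\theta_3}$. $(S_t)_{t\ge0}$ is an analytic $C_0$-semigroup on a separable Banach space $\mathcal B$ with $\|S_tx\|_{\theta+\sigma}\le Ct^{-\sigma}\|x\|_\theta$ and $\|S_tx-x\|_\theta\le Ct^\sigma\|x\|_{\theta+\sigma}$ for $x\in\mathcal B_{\theta+\sigma}$, $\theta\in\mathbb R$, $\sigma\in[0,1]$. $S_{t,s}:=S_{t-s}$. $\lesssim$: inequality up to a constant independent of the rough and controlled paths and of $s,t$. $\int_s^t$ is defined by the same limit along partitions of $[s,t]$. **Norms.** For a compact $I\subset\mathbb R$ and Banach space $U$: $\mathcal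 C_n(I,U)$ is the space of continuous maps $\{t_1\ge\dots\ge t_n\}\subset I^n\to U$. For $f\in\mathcal C_2(I,U)$, $\|f\|_{\beta,U}=\sup_{t>s}\|f_{t,s}\|_U/|t-s|^\beta$; for $f\in\mathcal C_3(I,U)$, $\|f\|_{\alpha_1,\alpha_2,U}=\sup\|f_{t_1,t_2,t_3}\|_U/(|t_3-t_2|^{\alpha_1}|t_2-t_1|^{\alpha_2})$ over $t_1>t_2>t_3$. For $f\in\mathcal C_1(I,U)$, $\delta f_{t,s}=f_t-f_s$, $\|f\|_{\infty,U}=\sup_t\|f_t\|_U$, $\|f\|_{\beta,U}=\|f\|_{\infty,U}+\|\delta f\|_{\beta,U}$. For $f\in\mathcal C_2$, $\delta f_{t,u,s}=f_{t,s}-f_{t,u}-f_{u,s}$. $\mathcal C_1^\beta,\mathcal C_2^\beta,\mathcal C_3^{\alpha_1,\alpha_2}$ denote the functions with $\|\delta f\|_{\beta,U}$, $\|f\|_{\beta,U}$, $\|f\|_{\alpha_1,\alpha_2,U}$ finite. If $U=\mathcal B_\theta$, write $\theta$ in place of $U$; norms of tuples (including the index $i$) are sums over components. **The norm of $\mathcal J^\alpha_\theta(I)$.** $\mathcal J^\alpha_\theta(I)$ consists of two-parameter functions $f=f^1+f^2$ with $\delta f=f^3+f^4$, where $f^1\in\mathcal C_2^\alpha(I,\mathcal B_\theta)$, $f^2\in\mathcal C_2^{2\alpha}(I,\mathcal B_{\theta-\alpha})$, $f^3\in\mathcal C_3^{2\alpha,\alpha}(I,\mathcal B_{\theta-2\alpha})$,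 $f^4\in\mathcal C_3^{\alpha,2\alpha}(I,\mathcal B_{\theta-2\alpha})$; $\|f\|_{\mathcal J^\alpha_\theta}$ is the infimum over such decompositions of $\|f^1\|_{\alpha,\theta}+\|f^2\|_{2\alpha,\theta-\alpha}+\|f^3\|_{2\alpha,\alpha,\theta-2\alpha}+\|f^4\|_{\alpha,2\alpha,\theta-2\alpha}$. In (ii) it is applied to $f_{v,u}=y_u\cdot\delta X_{v,u}+y'_u:\mathbb X_{v,u}+\bar y'_u:\mathbb X(-r)_{v,u}$. **Delayed rough paths.** $X:\mathbb R\to\mathbb R^d$ is locally $\alpha$-Hölder. With $I_r=\{e: e\in I\text{ or }e+r\in I\}$, $(X,\mathbb X,\mathbb X(-r))\in\bar{\mathcal C}^\alpha(I,\mathbb R^d)$ means $X\in\mathcal C_1^\alpha(I_r,\mathbb R^d)$, $\mathbb X\in\mathcal C_2^{2\alpha}(I_r,\mathbb R^{d\times d})$, $\mathbb X(-r)\in\mathcal C_2^{2\alpha}(I,\mathbb R^{d\times d})$ and, for $t\ge u\ge s$ in $I$, $\mathbb X^{i,j}_{t,s}-\mathbb X^{i,j}_{u,s}-\mathbb X^{i,j}_{t,u}=\delta X^i_{u,s}\delta X^j_{t,u}$, $\mathbb X(-r)^{i,j}_{t,s}-\mathbb X(-r)^{i,j}_{u,s}-\mathbb X(-r)^{i,j}_{t,u}=\delta X^i_{u-r,s-r}\delta X^j_{t,u}$. $\rho_{\alpha,I}(\bar{\mathbf X})=\|\delta X\|_\alpha+\|\mathbb X\|_{2\alpha}+\|\mathbb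 X(-r)\|_{2\alpha}$. **Delayed controlled paths.** $(y,y',\bar y')\in\mathcal D^{2\alpha}_{\bar{\mathbf X},\theta}(I)$ means $y\in\mathcal C_1(I,\mathcal B_\theta)$; $y',\bar y'$ are $d$-tuples of elements of $\mathcal C_1(I,\mathcal B_{\theta-\alpha})\cap\mathcal C_1^\alpha(I,\mathcal B_{\theta-2\alpha})$; and $\bar R^y_{t,s}=\delta y_{t,s}-\sum_jy'^{,j}_s\delta X^j_{t,s}-\sum_j\bar y'^{,j}_s\delta X^j_{t-r,s-r}$ lies in $\mathcal C_2^\alpha(I,\mathcal B_{\theta-\alpha})\cap\mathcal C_2^{2\alpha}(I,\mathcal B_{\theta-2\alpha})$. Norm: $\|y,y',\bar y'\|_{\bar{\mathbf X},2\alpha,\theta}=\|y\|_{\infty,\theta}+\|y'\|_{\infty,\theta-\alpha}+\|y'\|_{\alpha,\theta-2\alpha}+\|\bar y'\|_{\infty,\theta-\alpha}+\|\bar y'\|_{\alpha,\theta-2\alpha}+\|\bar R^y\|_{\alpha,\theta-\alpha}+\|\bar R^y\|_{2\alpha,\theta-2\alpha}$. *)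

theory Defs
  imports "HOL-Analysis.Analysis"
begin

section \<open>Normed spaces given by a carrier and a norm\<close>

text \<open>The spaces of an interpolation scale are indexed by a real number, hence they are modelled as
  subspaces of one ambient real vector space (think of the union of the scale), each with its own
  norm; the embeddings between them are then inclusions.\<close>

record 'a nspace =
  car :: "'a set"
  nrm :: "'a \<Rightarrow> real"

definition euclidean_nspace :: "'b::euclidean_space nspace" where
  "euclidean_nspace = \<lparr>car = UNIV, nrm = norm\<rparr>"

text \<open>The value 0 off the carrier is only there because the library locale \<open>Metric_space\<close> wants
  symmetry and nonnegativity on the whole type.\<close>

definition ndist :: "'a::real_vector nspace \<Rightarrow> 'a \<Rightarrow> 'a \<Rightarrow> real" where
  "ndist V x y = (if x \<in> car V \<and> y \<in> car V then nrm V (x - y) else 0)"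

definition ntop :: "'a::real_vector nspace \<Rightarrow> 'a topology" where
  "ntop V = Metric_space.mtopology (car V) (ndist V)"

locale separable_banach =
  fixes V :: "'a::real_vector nspace"
  assumes subspace_car: "subspace (car V)"
    and nrm_nonneg: "x \<in> car V \<Longrightarrow> 0 \<le> nrm V x"
    and nrm_eq_0_iff: "x \<in> car V \<Longrightarrow> nrm V x = 0 \<longleftrightarrow> x = 0"
    and nrm_scaleR: "x \<in> car V \<Longrightarrow> nrm V (c *\<^sub>R x) = \<bar>c\<bar> * nrm V x"
    and nrm_triangle: "x \<in> car V \<Longrightarrow> y \<in> car V \<Longrightarrow> nrm V (x + y) \<le> nrm V x + nrm V y"
    and complete: "Metric_space.mcomplete (car V) (ndist V)"
    and separable: "separable_space (ntop V)"
begin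

sublocale Metric_space "car V" "ndist V"
proof
  fix x y z
  show "0 \<le> ndist V x y"
    using subspace_car by (auto simp: ndist_def nrm_nonneg subspace_diff)
  show "ndist V x y = ndist V y x"
  proof (cases "x \<in> car V \<and> y \<in> car V")
    case True
    then have "nrm V ((-1) *\<^sub>R (x - y)) = nrm V (x - y)"
      using subspace_car nrm_scaleR[of "x - y" "-1"] by (simp add: subspace_diff)
    then show ?thesis using True by (simp add: ndist_def)
  qed (auto simp: ndist_def)
  show "ndist V x y = 0 \<longleftrightarrow> x = y" if "x \<in> car V" "y \<in> car V"
    using that subspace_car by (simp add: ndist_def nrm_eq_0_iff subspace_diff)
  show "ndist V x z \<le> ndist V x y + ndist V y z"
    if "x \<in> car V" "y \<in> car V" "z \<in> car V"
    using that subspace_car nrm_triangle[of "x - y" "y - z"]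
    by (simp add: ndist_def subspace_diff)
qed

end

definition bounded_linear_between ::
    "'a::real_vector nspace \<Rightarrow> 'b::real_vector nspace \<Rightarrow> ('a \<Rightarrow> 'b) \<Rightarrow> bool" where
  "bounded_linear_between V W f \<longleftrightarrow>
     (\<forall>x\<in>car V. f x \<in> car W) \<and>
     (\<forall>x\<in>car V. \<forall>y\<in>car V. f (x + y) = f x + f y) \<and>
     (\<forall>c. \<forall>x\<in>car V. f (c *\<^sub>R x) = c *\<^sub>R f x) \<and>
     (\<exists>C. \<forall>x\<in>car V. nrm W (f x) \<le> C * nrm V x)"


section \<open>Analytic semigroups\<close>

definition C0_semigroup :: "'a::real_vector nspace \<Rightarrow> (real \<Rightarrow> 'a \<Rightarrow> 'a) \<Rightarrow> bool" where
  "C0_semigroup B S \<longleftrightarrow>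
     (\<forall>t\<ge>0. bounded_linear_between B B (S t)) \<and>
     (\<forall>x\<in>car B. S 0 x = x) \<and>
     (\<forall>t\<ge>0. \<forall>s\<ge>0. \<forall>x\<in>car B. S (t + s) x = S t (S s x)) \<and>
     (\<forall>x\<in>car B. limitin (ntop B) (\<lambda>t. S t x) x (at_right 0))"

text \<open>The scalars are real, so analyticity refers to the complexification, where \<open>(x, y)\<close> stands for
  \<open>x + \<i> y\<close>. The norm below is not complex homogeneous, but it is equivalent to the usual
  complexification norms and only its topology and its bounded maps are used.\<close>

definition cscale :: "complex \<Rightarrow> 'a::real_vector \<times> 'a \<Rightarrow> 'a \<times> 'a" where
  "cscale c p = (Re c *\<^sub>R fst p - Im c *\<^sub>R snd p, Im c *\<^sub>R fst p + Re c *\<^sub>R snd p)"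

definition complexification :: "'a::real_vector nspace \<Rightarrow> ('a \<times> 'a) nspace" where
  "complexification B = \<lparr>car = car B \<times> car B, nrm = (\<lambda>p. nrm B (fst p) + nrm B (snd p))\<rparr>"

definition sector :: "real \<Rightarrow> complex set" where
  "sector \<phi> = {z. z \<noteq> 0 \<and> \<bar>Arg z\<bar> < \<phi>}"

text \<open>The semigroup extends to a sector as a strongly holomorphic, strongly continuous (at 0) family
  of bounded complex linear operators with the semigroup property. Restricting to angles
  \<open>\<phi> \<le> pi / 2\<close> is harmless, as the sector may be shrunk, and makes the sector closed under addition.\<close>

definition analytic_C0_semigroup :: "'a::real_vector nspace \<Rightarrow> (real \<Rightarrow> 'a \<Rightarrow> 'a) \<Rightarrow> bool" where
  "analytic_C0_semigroup B S \<longleftrightarrow> C0_semigroup B S \<and>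
     (\<exists>\<phi> (T :: complex \<Rightarrow> 'a \<times> 'a \<Rightarrow> 'a \<times> 'a). 0 < \<phi> \<and> \<phi> \<le> pi / 2 \<and>
        (\<forall>t\<ge>0. \<forall>x\<in>car B. \<forall>y\<in>car B. T (of_real t) (x, y) = (S t x, S t y)) \<and>
        (\<forall>z\<in>sector \<phi>. bounded_linear_between (complexification B) (complexification B) (T z)) \<and>
        (\<forall>z\<in>sector \<phi>. \<forall>c. \<forall>p\<in>car (complexification B). T z (cscale c p) = cscale c (T z p)) \<and>
        (\<forall>z\<in>sector \<phi>. \<forall>w\<in>sector \<phi>. \<forall>p\<in>car (complexification B). T (z + w) p = T z (T w p)) \<and>
        (\<forall>z\<in>sector \<phi>. \<forall>p\<in>car (complexification B). \<exists>q.
           limitin (ntop (complexification B)) (\<lambda>w. cscale (1 / (w - z)) (T w p - T z p)) q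
             (at z within sector \<phi>)) \<and>
        (\<forall>p\<in>car (complexification B).
           limitin (ntop (complexification B)) (\<lambda>z. T z p) p (at 0 within sector \<phi>)))"


section \<open>Interpolation scales with a smoothing semigroup\<close>

locale interpolation_scale =
  fixes V :: "real \<Rightarrow> 'a::real_vector nspace"
  assumes banach: "separable_banach (V \<theta>)"
    and car_mono: "\<theta>1 \<le> \<theta>2 \<Longrightarrow> car (V \<theta>2) \<subseteq> car (V \<theta>1)"
    and continuous_embedding: "\<theta>1 \<le> \<theta>2 \<Longrightarrow> continuous_map (ntop (V \<theta>2)) (ntop (V \<theta>1)) (\<lambda>x. x)"
    and dense_embedding: "\<theta>1 \<le> \<theta>2 \<Longrightarrow> ntop (V \<theta>1) closure_of car (V \<theta>2) = car (V \<theta>1)"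
    and interpolation: "\<theta>1 \<le> \<theta>2 \<Longrightarrow> \<theta>2 \<le> \<theta>3 \<Longrightarrow> \<exists>C. \<forall>x\<in>car (V \<theta>3).
          nrm (V \<theta>2) x powr (\<theta>3 - \<theta>1)
            \<le> C * nrm (V \<theta>1) x powr (\<theta>3 - \<theta>2) * nrm (V \<theta>3) x powr (\<theta>2 - \<theta>1)"

text \<open>\<open>B\<close> is the space on which \<open>S\<close> is an analytic semigroup (typically \<open>V 0\<close>); \<open>S t\<close> also denotes
  the restrictions and extensions to the spaces of the scale. As usual, the constants in the
  smoothing estimates may depend on \<open>\<theta>\<close> and \<open>\<sigma>\<close>, and they are uniform on bounded time
  intervals; uniformity over all times would exclude, e.g., the heat semigroup on a torus.\<close>

locale smoothing_semigroup = interpolation_scale V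
  for V :: "real \<Rightarrow> 'a::real_vector nspace" +
  fixes B :: "'a nspace" and S :: "real \<Rightarrow> 'a \<Rightarrow> 'a"
  assumes banach_B: "separable_banach B"
    and analytic: "analytic_C0_semigroup B S"
    and S_add: "0 \<le> t \<Longrightarrow> x \<in> car (V \<theta>) \<Longrightarrow> y \<in> car (V \<theta>) \<Longrightarrow> S t (x + y) = S t x + S t y"
    and S_scaleR: "0 \<le> t \<Longrightarrow> x \<in> car (V \<theta>) \<Longrightarrow> S t (c *\<^sub>R x) = c *\<^sub>R S t x"
    and S_0: "x \<in> car (V \<theta>) \<Longrightarrow> S 0 x = x"
    and S_plus: "0 \<le> t \<Longrightarrow> 0 \<le> s \<Longrightarrow> x \<in> car (V \<theta>) \<Longrightarrow> S (t + s) x = S t (S s x)"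
    and smoothing: "0 \<le> \<sigma> \<Longrightarrow> \<sigma> \<le> 1 \<Longrightarrow> \<exists>C. \<forall>t\<in>{0<..T}. \<forall>x\<in>car (V \<theta>).
          S t x \<in> car (V (\<theta> + \<sigma>)) \<and> nrm (V (\<theta> + \<sigma>)) (S t x) \<le> C * t powr (- \<sigma>) * nrm (V \<theta>) x"
    and time_regularity: "0 \<le> \<sigma> \<Longrightarrow> \<sigma> \<le> 1 \<Longrightarrow> \<exists>C. \<forall>t\<in>{0..T}. \<forall>x\<in>car (V (\<theta> + \<sigma>)).
          nrm (V \<theta>) (S t x - x) \<le> C * t powr \<sigma> * nrm (V (\<theta> + \<sigma>)) x"


section \<open>Hoelder spaces of functions of one, two and three parameters\<close>

text \<open>Functions of several times take the largest time first. Norms are extended nonnegative reals,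
  so that finiteness expresses membership.\<close>

definition simplex2 :: "real set \<Rightarrow> (real \<times> real) set" where
  "simplex2 I = {(t, s). t \<in> I \<and> s \<in> I \<and> s \<le> t}"

definition simplex3 :: "real set \<Rightarrow> (real \<times> real \<times> real) set" where
  "simplex3 I = {(t, u, s). t \<in> I \<and> u \<in> I \<and> s \<in> I \<and> s \<le> u \<and> u \<le> t}"

definition C1 :: "real set \<Rightarrow> 'b::real_vector nspace \<Rightarrow> (real \<Rightarrow> 'b) set" where
  "C1 I U = {f. continuous_map (top_of_set I) (ntop U) f}"

definition C2 :: "real set \<Rightarrow> 'b::real_vector nspace \<Rightarrow> (real \<Rightarrow> real \<Rightarrow> 'b) set" where
  "C2 I U = {f. continuous_map (top_of_set (simplex2 I)) (ntop U) (\<lambda>(t, s). f t s)}"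

definition C3 :: "real set \<Rightarrow> 'b::real_vector nspace \<Rightarrow> (real \<Rightarrow> real \<Rightarrow> real \<Rightarrow> 'b) set" where
  "C3 I U = {f. continuous_map (top_of_set (simplex3 I)) (ntop U) (\<lambda>(t, u, s). f t u s)}"

definition delta1 :: "(real \<Rightarrow> 'b::real_vector) \<Rightarrow> real \<Rightarrow> real \<Rightarrow> 'b" where
  "delta1 f t s = f t - f s"

definition delta2 :: "(real \<Rightarrow> real \<Rightarrow> 'b::real_vector) \<Rightarrow> real \<Rightarrow> real \<Rightarrow> real \<Rightarrow> 'b" where
  "delta2 f t u s = f t s - f t u - f u s"

definition sup_norm :: "real set \<Rightarrow> 'b nspace \<Rightarrow> (real \<Rightarrow> 'b) \<Rightarrow> ennreal" where
  "sup_norm I U f = (SUP t\<in>I. ennreal (nrm U (f t)))"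

definition hnorm2 :: "real \<Rightarrow> real set \<Rightarrow> 'b nspace \<Rightarrow> (real \<Rightarrow> real \<Rightarrow> 'b) \<Rightarrow> ennreal" where
  "hnorm2 \<beta> I U f =
     (SUP (t, s) \<in> {(t, s). t \<in> I \<and> s \<in> I \<and> s < t}. ennreal (nrm U (f t s) / (t - s) powr \<beta>))"

definition hnorm1 :: "real \<Rightarrow> real set \<Rightarrow> 'b::real_vector nspace \<Rightarrow> (real \<Rightarrow> 'b) \<Rightarrow> ennreal" where
  "hnorm1 \<beta> I U f = sup_norm I U f + hnorm2 \<beta> I U (delta1 f)"

definition hnorm3 ::
    "real \<Rightarrow> real \<Rightarrow> real set \<Rightarrow> 'b nspace \<Rightarrow> (real \<Rightarrow> real \<Rightarrow> real \<Rightarrow> 'b) \<Rightarrow> ennreal" where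
  "hnorm3 \<alpha>1 \<alpha>2 I U f =
     (SUP (t1, t2, t3) \<in> {(t1, t2, t3). t1 \<in> I \<and> t2 \<in> I \<and> t3 \<in> I \<and> t3 < t2 \<and> t2 < t1}.
        ennreal (nrm U (f t1 t2 t3) / ((t2 - t3) powr \<alpha>1 * (t1 - t2) powr \<alpha>2)))"

definition C1_hoelder :: "real \<Rightarrow> real set \<Rightarrow> 'b::real_vector nspace \<Rightarrow> (real \<Rightarrow> 'b) set" where
  "C1_hoelder \<beta> I U = {f \<in> C1 I U. hnorm2 \<beta> I U (delta1 f) < \<infinity>}"

definition C2_hoelder ::
    "real \<Rightarrow> real set \<Rightarrow> 'b::real_vector nspace \<Rightarrow> (real \<Rightarrow> real \<Rightarrow> 'b) set" where
  "C2_hoelder \<beta> I U = {f \<in> C2 I U. hnorm2 \<beta> I U f < \<infinity>}"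

definition C3_hoelder ::
    "real \<Rightarrow> real \<Rightarrow> real set \<Rightarrow> 'b::real_vector nspace \<Rightarrow> (real \<Rightarrow> real \<Rightarrow> real \<Rightarrow> 'b) set" where
  "C3_hoelder \<alpha>1 \<alpha>2 I U = {f \<in> C3 I U. hnorm3 \<alpha>1 \<alpha>2 I U f < \<infinity>}"

text \<open>The infimum over the empty set is \<open>\<infinity>\<close>, so \<open>J_norm\<close> is finite exactly on the space
  \<open>J\<close> of functions admitting a decomposition.\<close>

definition J_decompositions ::
    "real \<Rightarrow> (real \<Rightarrow> 'a::real_vector nspace) \<Rightarrow> real \<Rightarrow> real set \<Rightarrow> (real \<Rightarrow> real \<Rightarrow> 'a) \<Rightarrow>
      ((real \<Rightarrow> real \<Rightarrow> 'a) \<times> (real \<Rightarrow> real \<Rightarrow> 'a) \<times>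
       (real \<Rightarrow> real \<Rightarrow> real \<Rightarrow> 'a) \<times> (real \<Rightarrow> real \<Rightarrow> real \<Rightarrow> 'a)) set" where
  "J_decompositions \<alpha> V \<theta> I f = {(f1, f2, f3, f4).
     f1 \<in> C2_hoelder \<alpha> I (V \<theta>) \<and>
     f2 \<in> C2_hoelder (2 * \<alpha>) I (V (\<theta> - \<alpha>)) \<and>
     f3 \<in> C3_hoelder (2 * \<alpha>) \<alpha> I (V (\<theta> - 2 * \<alpha>)) \<and>
     f4 \<in> C3_hoelder \<alpha> (2 * \<alpha>) I (V (\<theta> - 2 * \<alpha>)) \<and>
     (\<forall>(t, s) \<in> simplex2 I. f t s = f1 t s + f2 t s) \<and>
     (\<forall>(t, u, s) \<in> simplex3 I. delta2 f t u s = f3 t u s + f4 t u s)}"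

definition J_norm ::
    "real \<Rightarrow> (real \<Rightarrow> 'a::real_vector nspace) \<Rightarrow> real \<Rightarrow> real set \<Rightarrow> (real \<Rightarrow> real \<Rightarrow> 'a) \<Rightarrow> ennreal" where
  "J_norm \<alpha> V \<theta> I f = (INF (f1, f2, f3, f4) \<in> J_decompositions \<alpha> V \<theta> I f.
     hnorm2 \<alpha> I (V \<theta>) f1 + hnorm2 (2 * \<alpha>) I (V (\<theta> - \<alpha>)) f2 +
     hnorm3 (2 * \<alpha>) \<alpha> I (V (\<theta> - 2 * \<alpha>)) f3 + hnorm3 \<alpha> (2 * \<alpha>) I (V (\<theta> - 2 * \<alpha>)) f4)"


section \<open>Delayed rough paths and delayed controlled paths\<close>

definition locally_hoelder :: "real \<Rightarrow> (real \<Rightarrow> 'b::real_normed_vector) \<Rightarrow> bool" where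
  "locally_hoelder \<alpha> X \<longleftrightarrow>
     (\<forall>K. compact K \<longrightarrow> (\<exists>C. \<forall>s\<in>K. \<forall>t\<in>K. norm (X t - X s) \<le> C * \<bar>t - s\<bar> powr \<alpha>))"

definition delay_domain :: "real \<Rightarrow> real set \<Rightarrow> real set" where
  "delay_domain r I = {e. e \<in> I \<or> e + r \<in> I}"

text \<open>\<open>XX t s $ i $ j\<close> and \<open>Xr t s $ i $ j\<close> are the \<open>(i, j)\<close> components of the iterated integrals
  of \<open>X\<close> and of its delayed version, for times \<open>s \<le> t\<close>.\<close>

definition delayed_rough_path ::
    "real \<Rightarrow> real \<Rightarrow> real set \<Rightarrow> (real \<Rightarrow> real ^ 'd) \<Rightarrow> (real \<Rightarrow> real \<Rightarrow> real ^ 'd ^ 'd) \<Rightarrow>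
      (real \<Rightarrow> real \<Rightarrow> real ^ 'd ^ 'd) \<Rightarrow> bool" where
  "delayed_rough_path \<alpha> r I X XX Xr \<longleftrightarrow>
     locally_hoelder \<alpha> X \<and>
     X \<in> C1_hoelder \<alpha> (delay_domain r I) euclidean_nspace \<and>
     XX \<in> C2_hoelder (2 * \<alpha>) (delay_domain r I) euclidean_nspace \<and>
     Xr \<in> C2_hoelder (2 * \<alpha>) I euclidean_nspace \<and>
     (\<forall>(t, u, s) \<in> simplex3 I. \<forall>i j.
        XX t s $ i $ j - XX u s $ i $ j - XX t u $ i $ j = delta1 X u s $ i * delta1 X t u $ j) \<and>
     (\<forall>(t, u, s) \<in> simplex3 I. \<forall>i j.
        Xr t s $ i $ j - Xr u s $ i $ j - Xr t u $ i $ j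
          = delta1 X (u - r) (s - r) $ i * delta1 X t u $ j)"

definition rho ::
    "real \<Rightarrow> real \<Rightarrow> real set \<Rightarrow> (real \<Rightarrow> real ^ 'd) \<Rightarrow> (real \<Rightarrow> real \<Rightarrow> real ^ 'd ^ 'd) \<Rightarrow>
      (real \<Rightarrow> real \<Rightarrow> real ^ 'd ^ 'd) \<Rightarrow> ennreal" where
  "rho \<alpha> r I X XX Xr =
     hnorm2 \<alpha> (delay_domain r I) euclidean_nspace (delta1 X) +
     hnorm2 (2 * \<alpha>) (delay_domain r I) euclidean_nspace XX +
     hnorm2 (2 * \<alpha>) I euclidean_nspace Xr"

definition remainder ::
    "real \<Rightarrow> (real \<Rightarrow> real ^ 'd) \<Rightarrow> (real \<Rightarrow> 'a::real_vector) \<Rightarrow> ('d \<Rightarrow> real \<Rightarrow> 'a) \<Rightarrow>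
      ('d \<Rightarrow> real \<Rightarrow> 'a) \<Rightarrow> real \<Rightarrow> real \<Rightarrow> 'a" where
  "remainder r X y y' yr t s = delta1 y t s
     - (\<Sum>j\<in>UNIV. (delta1 X t s $ j) *\<^sub>R y' j s)
     - (\<Sum>j\<in>UNIV. (delta1 X (t - r) (s - r) $ j) *\<^sub>R yr j s)"

definition delayed_controlled_path ::
    "real \<Rightarrow> real \<Rightarrow> (real \<Rightarrow> 'a::real_vector nspace) \<Rightarrow> real \<Rightarrow> real set \<Rightarrow> (real \<Rightarrow> real ^ 'd) \<Rightarrow>
      (real \<Rightarrow> 'a) \<Rightarrow> ('d \<Rightarrow> real \<Rightarrow> 'a) \<Rightarrow> ('d \<Rightarrow> real \<Rightarrow> 'a) \<Rightarrow> bool" where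
  "delayed_controlled_path \<alpha> r V \<theta> I X y y' yr \<longleftrightarrow>
     y \<in> C1 I (V \<theta>) \<and>
     (\<forall>j. y' j \<in> C1 I (V (\<theta> - \<alpha>)) \<inter> C1_hoelder \<alpha> I (V (\<theta> - 2 * \<alpha>))) \<and>
     (\<forall>j. yr j \<in> C1 I (V (\<theta> - \<alpha>)) \<inter> C1_hoelder \<alpha> I (V (\<theta> - 2 * \<alpha>))) \<and>
     remainder r X y y' yr
       \<in> C2_hoelder \<alpha> I (V (\<theta> - \<alpha>)) \<inter> C2_hoelder (2 * \<alpha>) I (V (\<theta> - 2 * \<alpha>))"

definition controlled_norm ::
    "real \<Rightarrow> real \<Rightarrow> (real \<Rightarrow> 'a::real_vector nspace) \<Rightarrow> real \<Rightarrow> real set \<Rightarrow> (real \<Rightarrow> real ^ 'd) \<Rightarrow>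
      (real \<Rightarrow> 'a) \<Rightarrow> ('d \<Rightarrow> real \<Rightarrow> 'a) \<Rightarrow> ('d \<Rightarrow> real \<Rightarrow> 'a) \<Rightarrow> ennreal" where
  "controlled_norm \<alpha> r V \<theta> I X y y' yr =
     sup_norm I (V \<theta>) y +
     (\<Sum>j\<in>UNIV. sup_norm I (V (\<theta> - \<alpha>)) (y' j)) + (\<Sum>j\<in>UNIV. hnorm1 \<alpha> I (V (\<theta> - 2 * \<alpha>)) (y' j)) +
     (\<Sum>j\<in>UNIV. sup_norm I (V (\<theta> - \<alpha>)) (yr j)) + (\<Sum>j\<in>UNIV. hnorm1 \<alpha> I (V (\<theta> - 2 * \<alpha>)) (yr j)) +
     hnorm2 \<alpha> I (V (\<theta> - \<alpha>)) (remainder r X y y' yr) +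
     hnorm2 (2 * \<alpha>) I (V (\<theta> - 2 * \<alpha>)) (remainder r X y y' yr)"

text \<open>The germ at \<open>(v, u)\<close>; note the transposed indices in the contractions.\<close>

definition germ ::
    "(real \<Rightarrow> real ^ 'd) \<Rightarrow> (real \<Rightarrow> real \<Rightarrow> real ^ 'd ^ 'd) \<Rightarrow> (real \<Rightarrow> real \<Rightarrow> real ^ 'd ^ 'd) \<Rightarrow>
      ('d \<Rightarrow> real \<Rightarrow> 'a::real_vector) \<Rightarrow> ('d \<Rightarrow> 'd \<Rightarrow> real \<Rightarrow> 'a) \<Rightarrow> ('d \<Rightarrow> 'd \<Rightarrow> real \<Rightarrow> 'a) \<Rightarrow>
      real \<Rightarrow> real \<Rightarrow> 'a" where
  "germ X XX Xr y y' yr v u =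
     (\<Sum>i\<in>UNIV. (delta1 X v u $ i) *\<^sub>R y i u) +
     (\<Sum>i\<in>UNIV. \<Sum>j\<in>UNIV. (XX v u $ j $ i) *\<^sub>R y' i j u) +
     (\<Sum>i\<in>UNIV. \<Sum>j\<in>UNIV. (Xr v u $ j $ i) *\<^sub>R yr i j u)"


section \<open>Rough convolutions\<close>

text \<open>A partition is a set of intervals \<open>K = {u..v}\<close>, with \<open>u = Inf K\<close> and \<open>v = Sup K\<close>. The library's
  \<open>division_of\<close> admits degenerate intervals; these do not contribute to the sums
  because the germ vanishes at \<open>(u, u)\<close>.\<close>

definition mesh_to_0 :: "real \<Rightarrow> real \<Rightarrow> real set set filter" where
  "mesh_to_0 s t = (INF \<delta>\<in>{0<..}. principal {P. P division_of {s..t} \<and> (\<forall>K\<in>P. Sup K - Inf K < \<delta>)})"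

definition has_rough_convolution ::
    "'a::real_vector nspace \<Rightarrow> (real \<Rightarrow> 'a \<Rightarrow> 'a) \<Rightarrow> (real \<Rightarrow> real \<Rightarrow> 'a) \<Rightarrow> real \<Rightarrow> real \<Rightarrow> 'a \<Rightarrow> bool" where
  "has_rough_convolution W S f s t z \<longleftrightarrow>
     limitin (ntop W) (\<lambda>P. \<Sum>K\<in>P. S (t - Inf K) (f (Sup K) (Inf K))) z (mesh_to_0 s t)"

definition rough_convolution ::
    "'a::real_vector nspace \<Rightarrow> (real \<Rightarrow> 'a \<Rightarrow> 'a) \<Rightarrow> (real \<Rightarrow> real \<Rightarrow> 'a) \<Rightarrow> real \<Rightarrow> real \<Rightarrow> 'a" where
  "rough_convolution W S f s t = (THE z. has_rough_convolution W S f s t z)"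

end

theory Submission
  imports Defs
begin

text \<open>Write \<open>\<Xi> v u = S (t - u) (f v u)\<close> for the convolved germ, where \<open>f\<close> is the germ of \<open>y\<close>. Two
  facts make the theorem true.

  \<^emph>\<open>The convolved germ is almost additive of order \<open>3 \<alpha> > 1\<close>.\<close> Inserting a time \<open>m\<close> between \<open>u\<close> and
  \<open>v\<close> changes \<open>\<Xi> v u\<close> by \<open>S (t - u)\<close> applied to \<open>delta2 f v m u\<close>, which is of order \<open>3 \<alpha>\<close> in the
  space of index \<open>\<theta> - 2 \<alpha>\<close> by the definition of \<open>J_norm\<close>, and by \<open>S (t - m) (S (m - u) - 1) f v m\<close>,
  where the regularity in space of the two components of \<open>f\<close> is exchanged for the missing powers of
  time (lemma \<open>convolved_delta2\<close>). By the sewing lemma (\<open>almost_additive.sewing\<close>) the Riemann sums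
  converge in \<open>V (\<theta> - 2 * \<alpha>)\<close>, and the limit differs from \<open>\<Xi> t s\<close> by a multiple of
  \<open>(t - s) powr (3 \<alpha>)\<close>. The sewing lemma is proved in two steps: a bound for the sum over a partition
  that does not depend on the number of points yields an additive function close to the germ as a
  limit of dyadic sums; any additive function that close to the germ is the limit along all
  partitions, since it telescopes.

  \<^emph>\<open>The semigroup smoothes away from \<open>t\<close>.\<close> In the norm of index \<open>\<theta> - 2 \<alpha> + \<beta>\<close> the local errors carry the
  singular factor \<open>(t - m) powr - \<beta>\<close>. Along times approaching \<open>t\<close> geometrically, interval lengths are
  comparable to the distance from \<open>t\<close>, and the errors form a geometric series of total order
  \<open>3 \<alpha> - \<beta>\<close> (\<open>rough_convolution_estimate\<close>). All constants depend on the semigroup, the exponents and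
  \<open>T\<close> only, hence the bound survives the infimum over all decompositions of the germ
  (\<open>rough_convolution_J_norm\<close>).

  The second inequality in (ii) is algebra: by Chen's relations the germ of a delayed controlled path
  has an explicit decomposition whose four seminorms are bounded by products of seminorms of the
  rough path and of the controlled path (\<open>delta2_germ\<close>, \<open>J_norm_germ_le\<close>).\<close>

section \<open>Normed spaces with a carrier\<close>

context separable_banach
begin

lemma zero_car [simp, intro]: "0 \<in> car V"
  by (rule subspace_0[OF subspace_car])

lemma add_car [intro]: "x \<in> car V \<Longrightarrow> y \<in> car V \<Longrightarrow> x + y \<in> car V"
  by (rule subspace_add[OF subspace_car])

lemma diff_car [intro]: "x \<in> car V \<Longrightarrow> y \<in> car V \<Longrightarrow> x - y \<in> car V"
  by (rule subspace_diff[OF subspace_car])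

lemma uminus_car [intro]: "x \<in> car V \<Longrightarrow> - x \<in> car V"
  by (rule subspace_neg[OF subspace_car])

lemma scaleR_car [intro]: "x \<in> car V \<Longrightarrow> c *\<^sub>R x \<in> car V"
  by (rule subspace_scale[OF subspace_car])

lemma sum_car [intro]: "(\<And>i. i \<in> A \<Longrightarrow> f i \<in> car V) \<Longrightarrow> sum f A \<in> car V"
  by (rule subspace_sum[OF subspace_car])

lemma delta2_car:
  "f t s \<in> car V \<Longrightarrow> f t u \<in> car V \<Longrightarrow> f u s \<in> car V \<Longrightarrow> delta2 f t u s \<in> car V"
  unfolding delta2_def by (intro diff_car)

lemma nrm_zero [simp]: "nrm V 0 = 0"
  using nrm_eq_0_iff by blast

lemma nrm_uminus: "x \<in> car V \<Longrightarrow> nrm V (- x) = nrm V x"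
  using nrm_scaleR[of x "- 1"] by simp

lemma nrm_minus_commute: "x \<in> car V \<Longrightarrow> y \<in> car V \<Longrightarrow> nrm V (x - y) = nrm V (y - x)"
  using nrm_uminus[of "x - y"] by (simp add: diff_car)

lemma nrm_triangle_minus: "x \<in> car V \<Longrightarrow> y \<in> car V \<Longrightarrow> nrm V (x - y) \<le> nrm V x + nrm V y"
  using nrm_triangle[of x "- y"] by (simp add: nrm_uminus uminus_car)

lemma nrm_sum: "(\<And>i. i \<in> A \<Longrightarrow> f i \<in> car V) \<Longrightarrow> nrm V (sum f A) \<le> (\<Sum>i\<in>A. nrm V (f i))"
proof (induction A rule: infinite_finite_induct)
  case (insert i A)
  then show ?case
    using nrm_triangle[of "f i" "sum f A"] by (fastforce simp: sum_car)
qed auto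

lemma limitin_iff:
  "limitin (ntop V) f l F \<longleftrightarrow>
     l \<in> car V \<and> (\<forall>\<^sub>F x in F. f x \<in> car V) \<and> ((\<lambda>x. nrm V (f x - l)) \<longlongrightarrow> 0) F"
proof -
  have "((\<lambda>x. ndist V (f x) l) \<longlongrightarrow> 0) F \<longleftrightarrow> ((\<lambda>x. nrm V (f x - l)) \<longlongrightarrow> 0) F"
    if "l \<in> car V" "\<forall>\<^sub>F x in F. f x \<in> car V"
    using that(2) by (intro tendsto_cong) (auto elim!: eventually_mono simp: ndist_def that(1))
  then show ?thesis
    unfolding ntop_def limitin_metric_dist_null by blast
qed

lemma limitin_unique:
  "limitin (ntop V) f l F \<Longrightarrow> limitin (ntop V) f m F \<Longrightarrow> F \<noteq> bot \<Longrightarrow> l = m"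
  unfolding ntop_def by (rule limitin_metric_unique)

lemma limitin_const: "l \<in> car V \<Longrightarrow> limitin (ntop V) (\<lambda>_. l) l F"
  unfolding limitin_iff by simp

lemma limitin_add:
  assumes "limitin (ntop V) f l F" "limitin (ntop V) g m F"
  shows "limitin (ntop V) (\<lambda>x. f x + g x) (l + m) F"
proof -
  have lm: "l \<in> car V" "m \<in> car V" and ev: "\<forall>\<^sub>F x in F. f x \<in> car V \<and> g x \<in> car V"
    using assms by (auto simp: limitin_iff eventually_conj_iff)
  have "((\<lambda>x. nrm V (f x + g x - (l + m))) \<longlongrightarrow> 0) F"
  proof (rule tendsto_sandwich)
    show "\<forall>\<^sub>F x in F. 0 \<le> nrm V (f x + g x - (l + m))"
      using ev by (rule eventually_mono) (auto intro!: nrm_nonneg lm)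
    show "\<forall>\<^sub>F x in F. nrm V (f x + g x - (l + m)) \<le> nrm V (f x - l) + nrm V (g x - m)"
      using ev
    proof (rule eventually_mono)
      fix x assume "f x \<in> car V \<and> g x \<in> car V"
      then show "nrm V (f x + g x - (l + m)) \<le> nrm V (f x - l) + nrm V (g x - m)"
        using nrm_triangle[of "f x - l" "g x - m"] lm by (simp add: diff_car algebra_simps)
    qed
    show "((\<lambda>x. nrm V (f x - l) + nrm V (g x - m)) \<longlongrightarrow> 0) F"
      using tendsto_add[of _ 0 F _ 0] assms by (fastforce simp: limitin_iff)
  qed auto
  then show ?thesis
    using lm ev by (auto simp: limitin_iff elim!: eventually_mono)
qed

lemma limitin_scaleR:
  assumes "(c \<longlongrightarrow> d) F" "limitin (ntop V) f l F"
  shows "limitin (ntop V) (\<lambda>x. c x *\<^sub>R f x) (d *\<^sub>R l) F"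
proof -
  have l: "l \<in> car V" and ev: "\<forall>\<^sub>F x in F. f x \<in> car V"
    using assms by (auto simp: limitin_iff)
  have "((\<lambda>x. nrm V (c x *\<^sub>R f x - d *\<^sub>R l)) \<longlongrightarrow> 0) F"
  proof (rule tendsto_sandwich)
    show "\<forall>\<^sub>F x in F. 0 \<le> nrm V (c x *\<^sub>R f x - d *\<^sub>R l)"
      using ev by (rule eventually_mono) (auto intro!: nrm_nonneg l)
    show "\<forall>\<^sub>F x in F. nrm V (c x *\<^sub>R f x - d *\<^sub>R l)
            \<le> \<bar>c x\<bar> * nrm V (f x - l) + \<bar>c x - d\<bar> * nrm V l"
      using ev
    proof (rule eventually_mono)
      fix x assume x: "f x \<in> car V"
      have "c x *\<^sub>R f x - d *\<^sub>R l = c x *\<^sub>R (f x - l) + (c x - d) *\<^sub>R l"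
        by (simp add: algebra_simps)
      then show "nrm V (c x *\<^sub>R f x - d *\<^sub>R l) \<le> \<bar>c x\<bar> * nrm V (f x - l) + \<bar>c x - d\<bar> * nrm V l"
        using nrm_triangle[of "c x *\<^sub>R (f x - l)" "(c x - d) *\<^sub>R l"] x l
        by (simp add: nrm_scaleR diff_car scaleR_car)
    qed
    have "((\<lambda>x. \<bar>c x\<bar> * nrm V (f x - l) + \<bar>c x - d\<bar> * nrm V l)
            \<longlongrightarrow> \<bar>d\<bar> * 0 + \<bar>d - d\<bar> * nrm V l) F"
      using assms by (intro tendsto_intros) (auto simp: limitin_iff)
    then show "((\<lambda>x. \<bar>c x\<bar> * nrm V (f x - l) + \<bar>c x - d\<bar> * nrm V l) \<longlongrightarrow> 0) F"
      by simp
  qed auto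
  then show ?thesis
    using l ev by (auto simp: limitin_iff elim!: eventually_mono)
qed

lemma limitin_diff:
  assumes "limitin (ntop V) f l F" "limitin (ntop V) g m F"
  shows "limitin (ntop V) (\<lambda>x. f x - g x) (l - m) F"
  using limitin_add[OF assms(1) limitin_scaleR[OF tendsto_const assms(2), of "-1"]] by simp

lemma limitin_sum:
  assumes "\<And>i. i \<in> A \<Longrightarrow> limitin (ntop V) (f i) (l i) F"
  shows "limitin (ntop V) (\<lambda>x. \<Sum>i\<in>A. f i x) (\<Sum>i\<in>A. l i) F"
  using assms
proof (induction A rule: infinite_finite_induct)
  case (insert i A)
  then show ?case by (simp add: limitin_add)
qed (simp_all add: ntop_def)

lemma limitin_nrm_le:
  assumes lim: "limitin (ntop V) f l F" and "F \<noteq> bot"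
    and le: "\<forall>\<^sub>F x in F. nrm V (f x) \<le> c"
  shows "nrm V l \<le> c"
proof -
  have l: "l \<in> car V" and ev: "\<forall>\<^sub>F x in F. f x \<in> car V"
    and t: "((\<lambda>x. nrm V (f x - l)) \<longlongrightarrow> 0) F"
    using lim by (auto simp: limitin_iff)
  have "\<forall>\<^sub>F x in F. nrm V l - c \<le> nrm V (f x - l)"
    using ev le
  proof eventually_elim
    case (elim x)
    then show ?case
      using nrm_triangle_minus[of "f x" "f x - l"] l by (simp add: diff_car)
  qed
  from tendsto_lowerbound[OF t this \<open>F \<noteq> bot\<close>] show ?thesis by simp
qed

text \<open>Completeness enters the construction only in this form; the explicit bound on the distance to
  the first term carries the estimates to the limit.\<close>

lemma limitin_geometric:
  assumes x: "\<And>n. x n \<in> car V" and q: "0 \<le> q" "q < 1"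
    and step: "\<And>n. nrm V (x (Suc n) - x n) \<le> c * q ^ n"
  obtains l where "limitin (ntop V) x l sequentially" "nrm V (l - x 0) \<le> c / (1 - q)"
proof -
  have c: "0 \<le> c"
    using order_trans[OF nrm_nonneg step[of 0]] x by (auto simp: diff_car)
  have dist: "nrm V (x (m + k) - x m) \<le> c / (1 - q) * q ^ m" for m k
  proof -
    have "nrm V (x (m + k) - x m) = nrm V (\<Sum>i<k. x (Suc (m + i)) - x (m + i))"
      using sum_lessThan_telescope[of "\<lambda>i. x (m + i)" k] by simp
    also have "\<dots> \<le> (\<Sum>i<k. c * q ^ (m + i))"
      by (rule order_trans[OF nrm_sum]) (auto intro!: diff_car x sum_mono step)
    also have "\<dots> = c * q ^ m * (\<Sum>i<k. q ^ i)"
      by (simp add: power_add sum_distrib_left mult.assoc)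
    also have "\<dots> \<le> c * q ^ m * (1 / (1 - q))"
      using q c by (intro mult_left_mono) (auto simp: sum_gp_strict divide_simps)
    finally show ?thesis by (simp add: mult.commute)
  qed
  have "MCauchy x"
    unfolding MCauchy_def
  proof (intro conjI allI impI)
    show "range x \<subseteq> car V" using x by auto
    fix e :: real assume "e > 0"
    have "(\<lambda>m. c / (1 - q) * q ^ m) \<longlonglongrightarrow> c / (1 - q) * 0"
      using q by (intro tendsto_intros LIMSEQ_realpow_zero) auto
    then have "\<forall>\<^sub>F m in sequentially. c / (1 - q) * q ^ m < e"
      using \<open>e > 0\<close> by (intro order_tendstoD) auto
    then obtain N where N: "\<And>m. m \<ge> N \<Longrightarrow> c / (1 - q) * q ^ m < e"
      by (auto simp: eventually_sequentially)
    have *: "ndist V (x n') (x n) < e" if "N \<le> n" "n \<le> n'" for n n'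
      using dist[of n "n' - n"] N[of n] that x by (simp add: ndist_def)
    show "\<exists>N. \<forall>n n'. N \<le> n \<longrightarrow> N \<le> n' \<longrightarrow> ndist V (x n) (x n') < e"
      by (rule exI[of _ N]) (metis * commute linear)
  qed
  then obtain l where l: "limitin (ntop V) x l sequentially"
    using complete by (auto simp: mcomplete_def ntop_def)
  moreover have "nrm V (l - x 0) \<le> c / (1 - q)"
  proof (rule limitin_nrm_le)
    show "limitin (ntop V) (\<lambda>n. x n - x 0) (l - x 0) sequentially"
      by (rule limitin_diff[OF l limitin_const[OF x]])
    show "\<forall>\<^sub>F n in sequentially. nrm V (x n - x 0) \<le> c / (1 - q)"
      using dist[of 0] by simp
  qed simp
  ultimately show ?thesis using that by blast
qed

end


section \<open>Partitions of an interval\<close>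

lemma eventually_mesh_to_0:
  "eventually Q (mesh_to_0 s t) \<longleftrightarrow>
     (\<exists>\<delta>>0. \<forall>P. P division_of {s..t} \<and> (\<forall>K\<in>P. Sup K - Inf K < \<delta>) \<longrightarrow> Q P)"
  unfolding mesh_to_0_def
proof (subst eventually_INF_base)
  fix a b :: real assume "a \<in> {0<..}" "b \<in> {0<..}"
  then show "\<exists>x\<in>{0<..}. principal {P. P division_of {s..t} \<and> (\<forall>K\<in>P. Sup K - Inf K < x)}
      \<le> inf (principal {P. P division_of {s..t} \<and> (\<forall>K\<in>P. Sup K - Inf K < a)})
            (principal {P. P division_of {s..t} \<and> (\<forall>K\<in>P. Sup K - Inf K < b)})"
    by (intro bexI[of _ "min a b"]) auto
qed (auto simp: eventually_principal)

lemma mesh_to_0_division: "eventually (\<lambda>P. P division_of {s..t}) (mesh_to_0 s t)"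
  unfolding eventually_mesh_to_0 by (auto intro: exI[of _ 1])

lemma division_interval_cases:
  fixes s t :: real
  assumes "P division_of {s..t}" "K \<in> P"
  obtains u v where "K = {u..v}" "s \<le> u" "u \<le> v" "v \<le> t"
proof -
  obtain u v where "K = cbox u v" "K \<noteq> {}" "K \<subseteq> {s..t}"
    using division_ofD[OF assms(1)] assms(2) by metis
  then show ?thesis
    using that[of u v] by auto
qed

text \<open>Arbitrarily fine partitions exist by Cousin's lemma. Hence limits along \<open>mesh_to_0\<close> are unique,
  which makes \<open>rough_convolution\<close> meaningful.\<close>

lemma mesh_to_0_neq_bot: "mesh_to_0 s t \<noteq> bot"
proof
  assume "mesh_to_0 s t = bot"
  then obtain \<delta> where \<delta>: "\<delta> > 0"
      "\<And>P. \<not> (P division_of {s..t} \<and> (\<forall>K\<in>P. Sup K - Inf K < \<delta>))"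
    using eventually_mesh_to_0[of "\<lambda>_. False" s t] by auto
  obtain p where p: "p tagged_division_of {s..t}" "(\<lambda>x. ball x (\<delta>/3)) fine p"
    using fine_division_exists_real[OF gauge_ball[of "\<delta>/3"]] \<delta>(1) by auto
  have div: "snd ` p division_of {s..t}"
    by (rule division_of_tagged_division[OF p(1)])
  have fine: "Sup K - Inf K < \<delta>" if K: "K \<in> snd ` p" for K
  proof -
    obtain x where x: "K \<subseteq> ball x (\<delta>/3)"
      using K p(2) by (auto simp: fine_def)
    obtain u v where "K = {u..v}" "u \<le> v"
      using division_interval_cases[OF div K] .
    then have "dist x u < \<delta>/3" "dist x v < \<delta>/3" and K': "K = {u..v}" "u \<le> v"
      using subsetD[OF x, of u] subsetD[OF x, of v] by auto
    then have "v - u < \<delta>"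
      using \<delta>(1) unfolding dist_real_def abs_less_iff by linarith
    then show ?thesis using K' by simp
  qed
  show False using \<delta>(2)[of "snd ` p"] div fine by blast
qed

text \<open>The increment of \<open>F\<close> is an operative set function in the sense of the gauge integral, so it adds
  up over partitions given as mere sets of intervals, without enumerating the cells. Degenerate
  cells have increment 0.\<close>

lemma sum_division_telescope:
  fixes F :: "real \<Rightarrow> 'b::ab_group_add"
  assumes "P division_of {s..t}" "s \<le> t"
  shows "(\<Sum>K\<in>P. F (Sup K) - F (Inf K)) = F t - F s"
proof -
  let ?g = "\<lambda>K::real set. if K = {} then 0 else F (Sup K) - F (Inf K)"
  interpret operative_real plus 0 ?g
    rewrites "comm_monoid_set.F (+) 0 = sum"
    by standard[1] (auto simp add: sum_def)
  have "(\<Sum>K\<in>P. F (Sup K) - F (Inf K)) = sum ?g P"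
    using division_ofD(3)[OF assms(1)] by (intro sum.cong) auto
  also have "\<dots> = ?g {s..t}"
    using assms by (intro division) auto
  finally show ?thesis using assms(2) by simp
qed


section \<open>The sewing lemma\<close>

text \<open>A germ on \<open>{a..b}\<close> that fails to be additive only by terms of order \<open>\<gamma> > 1\<close>. The interval and
  the space are parameters because the same germ is sewn in two spaces and on various intervals.\<close>

locale almost_additive = separable_banach V for V :: "'a::real_vector nspace" +
  fixes \<Xi> :: "real \<Rightarrow> real \<Rightarrow> 'a" and a b K \<gamma> :: real
  assumes K_nonneg: "0 \<le> K" and \<gamma>_gt_1: "1 < \<gamma>"
    and germ_car: "a \<le> u \<Longrightarrow> u \<le> v \<Longrightarrow> v \<le> b \<Longrightarrow> \<Xi> v u \<in> car V"
    and nrm_delta2: "a \<le> u \<Longrightarrow> u \<le> m \<Longrightarrow> m \<le> v \<Longrightarrow> v \<le> b \<Longrightarrow>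
          nrm V (delta2 \<Xi> v m u) \<le> K * (v - u) powr \<gamma>"
begin

definition ratio :: real where "ratio = 2 powr (1 - \<gamma>)"

definition M :: real where "M = 2 / (1 - ratio)"

lemma ratio: "0 < ratio" "ratio < 1"
  using \<gamma>_gt_1 powr_less_mono[of "1 - \<gamma>" 0 2] by (auto simp: ratio_def)

lemma M_nonneg: "0 \<le> M"
  using ratio by (simp add: M_def)

lemma germ_diagonal: "a \<le> u \<Longrightarrow> u \<le> b \<Longrightarrow> \<Xi> u u = 0"
proof -
  assume u: "a \<le> u" "u \<le> b"
  then have "nrm V (- \<Xi> u u) \<le> 0"
    using nrm_delta2[of u u u] by (simp add: delta2_def)
  then show "\<Xi> u u = 0"
    using u germ_car[of u u] nrm_nonneg[of "\<Xi> u u"] by (simp add: nrm_uminus nrm_eq_0_iff)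
qed

lemma nrm_delta2_le:
  "a \<le> u \<Longrightarrow> u \<le> m \<Longrightarrow> m \<le> v \<Longrightarrow> v \<le> b \<Longrightarrow> v - u \<le> h \<Longrightarrow>
     nrm V (delta2 \<Xi> v m u) \<le> K * h powr \<gamma>"
  using K_nonneg \<gamma>_gt_1
  by (intro order_trans[OF nrm_delta2] mult_left_mono powr_mono2) auto

text \<open>Split the partition at the cell that contains the midpoint of the interval. Both remaining
  parts have at most half the length, so their errors together shrink by the factor \<open>ratio < 1\<close>,
  whatever the number of points; \<open>M\<close> is the fixed point of this recursion.\<close>

lemma maximal_inequality:
  assumes p: "mono p" and "i \<le> j" "a \<le> p i" "p j \<le> b"
  shows "nrm V ((\<Sum>k=i..<j. \<Xi> (p (Suc k)) (p k)) - \<Xi> (p j) (p i))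
           \<le> M * K * (p j - p i) powr \<gamma>"
  using assms(2-)
proof (induction "j - i" arbitrary: i j rule: less_induct)
  case less
  define L where "L = p j - p i"
  have L: "0 \<le> L" using p less.prems by (simp add: L_def monoD)
  show ?case
  proof (cases "i = j")
    case True
    then show ?thesis using less.prems germ_diagonal[of "p j"] by simp
  next
    case False
    \<comment> \<open>\<open>k\<close> is the last index whose point is not beyond the midpoint\<close>
    define A where "A = {k \<in> {i..<j}. p k \<le> (p i + p j) / 2}"
    define k where "k = Max A"
    have A: "finite A" "i \<in> A"
      using False less.prems L by (auto simp: A_def L_def)
    have "k \<in> A" using A Max_in[of A] unfolding k_def by blast
    then have k: "i \<le> k" "k < j" "p k - p i \<le> L / 2"
      by (auto simp: A_def L_def field_simps)
    have "p j - p (Suc k) \<le> L / 2"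
    proof (cases "Suc k = j")
      case False
      then have "Suc k \<notin> A" using A(1) Max_ge[of A "Suc k"] unfolding k_def by fastforce
      then show ?thesis using False k by (auto simp: A_def L_def field_simps)
    qed (use L in simp)
    note k = k this
    have pp: "p i \<le> p k" "p k \<le> p (Suc k)" "p (Suc k) \<le> p j"
      using k p by (auto intro: monoD)
    define s1 where "s1 = (\<Sum>k=i..<k. \<Xi> (p (Suc k)) (p k))"
    define s2 where "s2 = (\<Sum>k=Suc k..<j. \<Xi> (p (Suc k)) (p k))"
    have "\<Xi> (p (Suc l)) (p l) \<in> car V" if "i \<le> l" "l < j" for l
      using less.prems monoD[OF p, of i l] monoD[OF p, of l "Suc l"] monoD[OF p, of "Suc l" j] that
      by (intro germ_car) auto
    then have "s1 \<in> car V" "s2 \<in> car V"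
      unfolding s1_def s2_def using k by (auto intro!: sum_car)
    note car = this
      germ_car[of "p i" "p k"] germ_car[of "p k" "p (Suc k)"] germ_car[of "p (Suc k)" "p j"]
      germ_car[of "p i" "p j"] germ_car[of "p k" "p j"]
    have half: "x powr \<gamma> \<le> L powr \<gamma> * (ratio / 2)" if "0 \<le> x" "x \<le> L / 2" for x
    proof -
      have "x powr \<gamma> \<le> (L / 2) powr \<gamma>" using that \<gamma>_gt_1 by (intro powr_mono2) auto
      also have "\<dots> = L powr \<gamma> * (ratio / 2)"
        using L by (simp add: ratio_def powr_divide powr_diff)
      finally show ?thesis .
    qed
    have 1: "nrm V (s1 - \<Xi> (p k) (p i)) \<le> M * K * (L powr \<gamma> * (ratio / 2))"
    proof -
      have "nrm V (s1 - \<Xi> (p k) (p i)) \<le> M * K * (p k - p i) powr \<gamma>"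
        unfolding s1_def using k pp less.prems by (intro less.hyps) auto
      also have "\<dots> \<le> M * K * (L powr \<gamma> * (ratio / 2))"
        using k pp M_nonneg K_nonneg by (intro mult_left_mono half) auto
      finally show ?thesis .
    qed
    have 2: "nrm V (s2 - \<Xi> (p j) (p (Suc k))) \<le> M * K * (L powr \<gamma> * (ratio / 2))"
    proof -
      have "nrm V (s2 - \<Xi> (p j) (p (Suc k))) \<le> M * K * (p j - p (Suc k)) powr \<gamma>"
        unfolding s2_def using k pp less.prems by (intro less.hyps) auto
      also have "\<dots> \<le> M * K * (L powr \<gamma> * (ratio / 2))"
        using k pp M_nonneg K_nonneg by (intro mult_left_mono half) auto
      finally show ?thesis .
    qed
    have 3: "nrm V (delta2 \<Xi> (p j) (p k) (p i)) \<le> K * L powr \<gamma>"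
      using pp less.prems by (intro nrm_delta2_le) (auto simp: L_def)
    have 4: "nrm V (delta2 \<Xi> (p j) (p (Suc k)) (p k)) \<le> K * L powr \<gamma>"
      using pp less.prems by (intro nrm_delta2_le) (auto simp: L_def)
    have "(\<Sum>k=i..<j. \<Xi> (p (Suc k)) (p k)) = s1 + \<Xi> (p (Suc k)) (p k) + s2"
      unfolding s1_def s2_def using k
      by (metis (no_types, lifting) add.assoc less_imp_le sum.atLeastLessThan_concat
          sum.atLeast_Suc_lessThan)
    then have "(\<Sum>k=i..<j. \<Xi> (p (Suc k)) (p k)) - \<Xi> (p j) (p i)
        = (s1 - \<Xi> (p k) (p i)) + (s2 - \<Xi> (p j) (p (Suc k)))
          + (- delta2 \<Xi> (p j) (p k) (p i) + - delta2 \<Xi> (p j) (p (Suc k)) (p k))"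
      by (simp add: delta2_def)
    also have "nrm V \<dots> \<le> 2 * (M * K * (L powr \<gamma> * (ratio / 2))) + 2 * (K * L powr \<gamma>)"
    proof -
      have d: "delta2 \<Xi> (p j) (p k) (p i) \<in> car V" "delta2 \<Xi> (p j) (p (Suc k)) (p k) \<in> car V"
        unfolding delta2_def using car pp less.prems by (auto intro!: diff_car)
      have e: "s1 - \<Xi> (p k) (p i) \<in> car V" "s2 - \<Xi> (p j) (p (Suc k)) \<in> car V"
        using car pp less.prems by (auto intro!: diff_car)
      let ?x = "s1 - \<Xi> (p k) (p i)" and ?y = "s2 - \<Xi> (p j) (p (Suc k))"
        and ?d = "delta2 \<Xi> (p j) (p k) (p i)" and ?e = "delta2 \<Xi> (p j) (p (Suc k)) (p k)"
      have "nrm V (?x + ?y + (- ?d + - ?e)) \<le> nrm V ?x + nrm V ?y + (nrm V (- ?d) + nrm V (- ?e))"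
        using d e by (meson add_car add_mono nrm_triangle order_trans uminus_car)
      then show ?thesis using 1 2 3 4 d by (simp add: nrm_uminus)
    qed
    also have "\<dots> = (M * ratio + 2) * (K * L powr \<gamma>)" by (simp add: algebra_simps)
    also have "M * ratio + 2 = M"
      using ratio by (simp add: M_def field_simps)
    finally show ?thesis by (simp add: L_def mult.assoc)
  qed
qed

definition grid :: "nat \<Rightarrow> nat \<Rightarrow> real" where
  "grid n k = a + (b - a) * real k / 2 ^ n"

text \<open>Points beyond \<open>x\<close> are moved to \<open>x\<close>; the cells collapsed in this way contribute
  \<open>\<Xi> x x = 0\<close>, so that every sum has the same index set.\<close>

definition grid_sum :: "nat \<Rightarrow> real \<Rightarrow> 'a" where
  "grid_sum n x = (\<Sum>k<2 ^ n. \<Xi> (min x (grid n (Suc k))) (min x (grid n k)))"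

context
  assumes a_le_b: "a \<le> b"
begin

lemma grid_mono: "j \<le> k \<Longrightarrow> grid n j \<le> grid n k"
  using a_le_b by (simp add: grid_def divide_right_mono mult_left_mono)

lemma grid_ge: "a \<le> grid n k"
  using a_le_b by (simp add: grid_def)

lemma grid_0 [simp]: "grid n 0 = a" and grid_last [simp]: "grid n (2 ^ n) = b"
  by (simp_all add: grid_def)

lemma grid_step: "grid n (Suc k) - grid n k = (b - a) / 2 ^ n"
  by (simp add: grid_def field_simps)

lemma grid_double: "grid (Suc n) (2 * k) = grid n k"
  by (simp add: grid_def)

lemma grid_sum_car: "a \<le> x \<Longrightarrow> x \<le> b \<Longrightarrow> grid_sum n x \<in> car V"
  unfolding grid_sum_def
  by (intro sum_car germ_car) (auto simp: grid_ge grid_mono min.coboundedI1 min.coboundedI2)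

lemma grid_error: "2 ^ n * (K * ((b - a) / 2 ^ n) powr \<gamma>) = K * (b - a) powr \<gamma> * ratio ^ n"
proof -
  have "((2::real) ^ n) powr \<gamma> * ratio ^ n = 2 powr (real n * \<gamma>) * 2 powr (real n * (1 - \<gamma>))"
    by (simp add: ratio_def powr_power powr_powr mult.commute flip: powr_realpow)
  also have "\<dots> = 2 powr real n"
    by (simp add: algebra_simps flip: powr_add)
  also have "\<dots> = 2 ^ n" by (simp add: powr_realpow)
  finally have "((2::real) ^ n) powr \<gamma> * ratio ^ n = 2 ^ n" .
  then show ?thesis
    using a_le_b by (simp add: powr_divide field_simps)
qed

lemma nrm_grid_sum_step:
  assumes "a \<le> x" "x \<le> b"
  shows "nrm V (grid_sum (Suc n) x - grid_sum n x) \<le> K * (b - a) powr \<gamma> * ratio ^ n"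
proof -
  let ?g = "\<lambda>n k. min x (grid n k)"
  have double: "(\<Sum>k<2 * m. f k) = (\<Sum>k<m. f (2 * k) + f (Suc (2 * k)))" for f :: "nat \<Rightarrow> 'a" and m
    by (induction m) (simp_all add: algebra_simps)
  have g: "a \<le> ?g n k" "?g n k \<le> b" "j \<le> k \<Longrightarrow> ?g n j \<le> ?g n k" for n j k
    using assms grid_ge grid_mono by (auto simp: min_def intro: order_trans)
  have g2: "?g (Suc n) (Suc (Suc (2 * k))) = ?g n (Suc k)" for k
    using grid_double[of n "Suc k"] by simp
  have d: "delta2 \<Xi> (?g n (Suc k)) (?g (Suc n) (Suc (2 * k))) (?g n k) \<in> car V \<and>
      nrm V (delta2 \<Xi> (?g n (Suc k)) (?g (Suc n) (Suc (2 * k))) (?g n k))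
        \<le> K * ((b - a) / 2 ^ n) powr \<gamma>" for k
  proof -
    have o: "?g n k \<le> ?g (Suc n) (Suc (2 * k))" "?g (Suc n) (Suc (2 * k)) \<le> ?g n (Suc k)"
      using g(3)[of "2 * k" "Suc (2 * k)" "Suc n"] g(3)[of "Suc (2 * k)" "Suc (Suc (2 * k))" "Suc n"]
      unfolding g2 grid_double by auto
    have "?g n (Suc k) - ?g n k \<le> (b - a) / 2 ^ n"
      using grid_step[of n k] grid_mono[of k "Suc k" n] by (auto simp: min_def)
    then show ?thesis
      using o g by (intro conjI nrm_delta2_le delta2_car germ_car) (auto intro: order_trans)
  qed
  have "grid_sum (Suc n) x - grid_sum n x
      = (\<Sum>k<2 ^ n. - delta2 \<Xi> (?g n (Suc k)) (?g (Suc n) (Suc (2 * k))) (?g n k))"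
    unfolding grid_sum_def power_Suc double sum_subtractf[symmetric]
    by (intro sum.cong) (auto simp: delta2_def grid_double g2)
  also have "nrm V \<dots> \<le> (\<Sum>k<2 ^ n::nat. K * ((b - a) / 2 ^ n) powr \<gamma>)"
    using d by (intro order_trans[OF nrm_sum] sum_mono) (auto simp: nrm_uminus uminus_car)
  also have "\<dots> = K * (b - a) powr \<gamma> * ratio ^ n"
    using grid_error by simp
  finally show ?thesis .
qed

text \<open>The increment of the grid sum over \<open>{s..t}\<close> is the sum along the grid clamped to \<open>{s..t}\<close>, up
  to the cell that contains \<open>s\<close>. Only one cell is affected, but charging every cell with the same
  error costs nothing, since the total still decays like \<open>ratio ^ n\<close>.\<close>

lemma nrm_grid_sum_increment:
  assumes st: "a \<le> s" "s \<le> t" "t \<le> b"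
  shows "nrm V (grid_sum n t - grid_sum n s - \<Xi> t s)
           \<le> M * K * (t - s) powr \<gamma> + K * (b - a) powr \<gamma> * ratio ^ n"
proof -
  define q where "q k = max s (min t (grid n k))" for k
  have q: "mono q" "q 0 = s" "q (2 ^ n) = t"
    using st grid_mono unfolding q_def mono_def by (auto simp: max_def min_def intro: order_trans)
  have qcar: "\<Xi> (q (Suc k)) (q k) \<in> car V" for k
    using monoD[OF q(1), of k "Suc k"] st by (intro germ_car) (auto simp: q_def)
  let ?D = "\<lambda>k. \<Xi> (min t (grid n (Suc k))) (min t (grid n k))
        - \<Xi> (min s (grid n (Suc k))) (min s (grid n k)) - \<Xi> (q (Suc k)) (q k)"
  have D: "?D k \<in> car V \<and> nrm V (?D k) \<le> K * ((b - a) / 2 ^ n) powr \<gamma>" for k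
  proof -
    have g: "a \<le> grid n k" "grid n k \<le> grid n (Suc k)"
      using grid_ge grid_mono by auto
    consider "grid n (Suc k) \<le> s" | "s \<le> grid n k" | "grid n k < s" "s < grid n (Suc k)"
      by linarith
    then show ?thesis
    proof cases
      case 1
      then have "min t (grid n (Suc k)) = min s (grid n (Suc k))" "min t (grid n k) = min s (grid n k)"
        "q (Suc k) = s" "q k = s"
        using g st by (auto simp: q_def)
      then have "?D k = - \<Xi> s s" by simp
      then show ?thesis using germ_diagonal[of s] st K_nonneg by simp
    next
      case 2
      then have "?D k = - \<Xi> s s" using g st by (auto simp: q_def min_def max_def)
      then show ?thesis using germ_diagonal[of s] st K_nonneg by simp
    next
      case 3
      then have "?D k = delta2 \<Xi> (min t (grid n (Suc k))) s (grid n k)"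
        using g st by (auto simp: q_def min_def max_def delta2_def)
      moreover have "min t (grid n (Suc k)) - grid n k \<le> (b - a) / 2 ^ n"
        using grid_step[of n k] by (auto simp: min_def)
      ultimately show ?thesis
        using 3 g st by (auto intro!: nrm_delta2_le delta2_car germ_car)
    qed
  qed
  let ?Q = "\<Sum>k=0..<2 ^ n. \<Xi> (q (Suc k)) (q k)"
  have "grid_sum n t - grid_sum n s - \<Xi> t s = (?Q - \<Xi> t s) + (\<Sum>k<2 ^ n. ?D k)"
    unfolding grid_sum_def sum_subtractf atLeast0LessThan by simp
  then have "nrm V (grid_sum n t - grid_sum n s - \<Xi> t s) = nrm V ((?Q - \<Xi> t s) + (\<Sum>k<2 ^ n. ?D k))"
    by (rule arg_cong)
  also have "\<dots> \<le> nrm V (?Q - \<Xi> t s) + nrm V (\<Sum>k<2 ^ n. ?D k)"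
  proof (rule nrm_triangle)
    show "?Q - \<Xi> t s \<in> car V" using st by (intro diff_car sum_car qcar germ_car) auto
    show "(\<Sum>k<2 ^ n. ?D k) \<in> car V" using D by (intro sum_car) blast
  qed
  also have "\<dots> \<le> M * K * (t - s) powr \<gamma> + (\<Sum>k<2 ^ n::nat. K * ((b - a) / 2 ^ n) powr \<gamma>)"
  proof (rule add_mono)
    show "nrm V (?Q - \<Xi> t s) \<le> M * K * (t - s) powr \<gamma>"
      using maximal_inequality[OF q(1), of 0 "2 ^ n"] st unfolding q(2,3) by simp
    show "nrm V (\<Sum>k<2 ^ n. ?D k) \<le> (\<Sum>k<2 ^ n::nat. K * ((b - a) / 2 ^ n) powr \<gamma>)"
      using D by (intro order_trans[OF nrm_sum] sum_mono) auto
  qed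
  finally show ?thesis using grid_error by simp
qed

lemma additive_approximation:
  obtains F where "\<And>x. a \<le> x \<Longrightarrow> x \<le> b \<Longrightarrow> F x \<in> car V"
    and "\<And>s t. a \<le> s \<Longrightarrow> s \<le> t \<Longrightarrow> t \<le> b \<Longrightarrow>
           nrm V (F t - F s - \<Xi> t s) \<le> M * K * (t - s) powr \<gamma>"
proof -
  have "\<exists>l. a \<le> x \<longrightarrow> x \<le> b \<longrightarrow> limitin (ntop V) (\<lambda>n. grid_sum n x) l sequentially" for x
  proof (cases "a \<le> x \<and> x \<le> b")
    case True
    show ?thesis
    proof (rule limitin_geometric[of "\<lambda>n. grid_sum n x" ratio "K * (b - a) powr \<gamma>"])
      show "\<And>n. nrm V (grid_sum (Suc n) x - grid_sum n x) \<le> K * (b - a) powr \<gamma> * ratio ^ n"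
        using True by (intro nrm_grid_sum_step) auto
    qed (use True grid_sum_car ratio in auto)
  qed blast
  then obtain F where F: "\<And>x. a \<le> x \<Longrightarrow> x \<le> b \<Longrightarrow>
      limitin (ntop V) (\<lambda>n. grid_sum n x) (F x) sequentially"
    by metis
  show ?thesis
  proof (rule that)
    show "F x \<in> car V" if "a \<le> x" "x \<le> b" for x
      using F[OF that] by (simp add: limitin_iff)
    show "nrm V (F t - F s - \<Xi> t s) \<le> M * K * (t - s) powr \<gamma>"
      if st: "a \<le> s" "s \<le> t" "t \<le> b" for s t
    proof (rule field_le_epsilon)
      fix e :: real assume "e > 0"
      have "(\<lambda>n. K * (b - a) powr \<gamma> * ratio ^ n) \<longlonglongrightarrow> K * (b - a) powr \<gamma> * 0"
        using ratio by (intro tendsto_intros LIMSEQ_realpow_zero) auto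
      then have "\<forall>\<^sub>F n in sequentially. K * (b - a) powr \<gamma> * ratio ^ n < e"
        using \<open>e > 0\<close> by (intro order_tendstoD) auto
      then have "\<forall>\<^sub>F n in sequentially. nrm V (grid_sum n t - grid_sum n s - \<Xi> t s)
          \<le> M * K * (t - s) powr \<gamma> + e"
      proof (rule eventually_mono)
        fix n assume "K * (b - a) powr \<gamma> * ratio ^ n < e"
        then show "nrm V (grid_sum n t - grid_sum n s - \<Xi> t s) \<le> M * K * (t - s) powr \<gamma> + e"
          using nrm_grid_sum_increment[OF st, of n] by linarith
      qed
      moreover have "limitin (ntop V) (\<lambda>n. grid_sum n t - grid_sum n s - \<Xi> t s)
          (F t - F s - \<Xi> t s) sequentially"
        using st by (intro limitin_diff F limitin_const germ_car) auto
      ultimately show "nrm V (F t - F s - \<Xi> t s) \<le> M * K * (t - s) powr \<gamma> + e"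
        by (intro limitin_nrm_le[where F = sequentially]) auto
    qed
  qed
qed

end

text \<open>Once the additive function \<open>F\<close> is known, no refinements are needed to pass to arbitrary
  partitions: \<open>F\<close> telescopes over a partition, so its sum differs from that of \<open>\<Xi>\<close> by at most the
  sum of the \<open>\<gamma>\<close>-th powers of the lengths, and \<open>\<gamma> > 1\<close>.\<close>

lemma sewing:
  assumes "a \<le> b"
  obtains F where "\<And>x. a \<le> x \<Longrightarrow> x \<le> b \<Longrightarrow> F x \<in> car V"
    and "\<And>s t. a \<le> s \<Longrightarrow> s \<le> t \<Longrightarrow> t \<le> b \<Longrightarrow>
           nrm V (F t - F s - \<Xi> t s) \<le> 2 / (1 - 2 powr (1 - \<gamma>)) * K * (t - s) powr \<gamma>"
    and "\<And>s t. a \<le> s \<Longrightarrow> s \<le> t \<Longrightarrow> t \<le> b \<Longrightarrow>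
           limitin (ntop V) (\<lambda>P. \<Sum>K\<in>P. \<Xi> (Sup K) (Inf K)) (F t - F s) (mesh_to_0 s t)"
proof -
  obtain F where Fcar: "\<And>x. a \<le> x \<Longrightarrow> x \<le> b \<Longrightarrow> F x \<in> car V"
    and Fle: "\<And>s t. a \<le> s \<Longrightarrow> s \<le> t \<Longrightarrow> t \<le> b \<Longrightarrow>
           nrm V (F t - F s - \<Xi> t s) \<le> M * K * (t - s) powr \<gamma>"
    using additive_approximation[OF assms] by blast
  have lim: "limitin (ntop V) (\<lambda>P. \<Sum>K\<in>P. \<Xi> (Sup K) (Inf K)) (F t - F s) (mesh_to_0 s t)"
    if st: "a \<le> s" "s \<le> t" "t \<le> b" for s t
    unfolding limitin_iff
  proof (intro conjI)
    have cell: "\<Xi> (Sup I) (Inf I) \<in> car V" "\<Xi> (Sup I) (Inf I) - (F (Sup I) - F (Inf I)) \<in> car V"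
        "Inf I \<le> Sup I"
        "nrm V (\<Xi> (Sup I) (Inf I) - (F (Sup I) - F (Inf I))) \<le> M * K * (Sup I - Inf I) powr \<gamma>"
      if P: "P division_of {s..t}" "I \<in> P" for P I
    proof -
      obtain u v where I: "I = {u..v}" "s \<le> u" "u \<le> v" "v \<le> t"
        using division_interval_cases[OF P] .
      then have uv: "Inf I = u" "Sup I = v" by auto
      show "\<Xi> (Sup I) (Inf I) \<in> car V" "\<Xi> (Sup I) (Inf I) - (F (Sup I) - F (Inf I)) \<in> car V"
        unfolding uv using I st by (auto intro!: diff_car germ_car Fcar)
      show "Inf I \<le> Sup I" using I uv by simp
      show "nrm V (\<Xi> (Sup I) (Inf I) - (F (Sup I) - F (Inf I))) \<le> M * K * (Sup I - Inf I) powr \<gamma>"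
        unfolding uv using I st Fle[of u v]
        by (subst nrm_minus_commute) (auto intro!: diff_car germ_car Fcar)
    qed
    show "F t - F s \<in> car V" using Fcar st by (auto intro!: diff_car)
    show "\<forall>\<^sub>F P in mesh_to_0 s t. (\<Sum>K\<in>P. \<Xi> (Sup K) (Inf K)) \<in> car V"
      using mesh_to_0_division by (rule eventually_mono) (use cell in \<open>auto intro!: sum_car\<close>)
    show "((\<lambda>P. nrm V ((\<Sum>K\<in>P. \<Xi> (Sup K) (Inf K)) - (F t - F s))) \<longlongrightarrow> 0) (mesh_to_0 s t)"
    proof (rule tendstoI)
      fix e :: real assume "e > 0"
      \<comment> \<open>\<open>\<delta>\<close> solves \<open>M * K * (t - s) * \<delta> powr (\<gamma> - 1) < e\<close>; the summand 1 avoids a case distinction\<close>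
      define c where "c = M * K * (t - s) + 1"
      have c: "0 < c" using M_nonneg K_nonneg st by (simp add: c_def add_nonneg_pos)
      define \<delta> where "\<delta> = (e / c) powr (1 / (\<gamma> - 1))"
      have \<delta>: "0 < \<delta>" "\<delta> powr (\<gamma> - 1) = e / c"
        using \<open>e > 0\<close> c \<gamma>_gt_1 by (auto simp: \<delta>_def powr_powr)
      have "dist (nrm V ((\<Sum>K\<in>P. \<Xi> (Sup K) (Inf K)) - (F t - F s))) 0 < e"
        if P: "P division_of {s..t}" "\<forall>K\<in>P. Sup K - Inf K < \<delta>" for P
      proof -
        have nn: "0 \<le> nrm V ((\<Sum>K\<in>P. \<Xi> (Sup K) (Inf K)) - (F t - F s))"
          using cell[OF P(1)] st Fcar by (intro nrm_nonneg diff_car sum_car) auto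
        have "(\<Sum>K\<in>P. \<Xi> (Sup K) (Inf K)) - (F t - F s)
            = (\<Sum>I\<in>P. \<Xi> (Sup I) (Inf I) - (F (Sup I) - F (Inf I)))"
          using sum_division_telescope[OF P(1) st(2), of F] by (simp add: sum_subtractf)
        also have "nrm V \<dots> \<le> (\<Sum>I\<in>P. M * K * (Sup I - Inf I) powr \<gamma>)"
          using cell[OF P(1)]
          by (intro order_trans[OF nrm_sum] sum_mono) simp_all
        also have "\<dots> \<le> (\<Sum>I\<in>P. M * K * (e / c * (Sup I - Inf I)))"
        proof (intro sum_mono mult_left_mono)
          fix I assume I: "I \<in> P"
          have l: "0 \<le> Sup I - Inf I" "Sup I - Inf I < \<delta>"
            using cell[OF P(1) I] P(2) I by auto
          have "(Sup I - Inf I) powr \<gamma> = (Sup I - Inf I) powr (\<gamma> - 1) * (Sup I - Inf I)"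
            using l \<gamma>_gt_1 by (cases "Sup I = Inf I") (simp_all add: powr_diff)
          also have "\<dots> \<le> \<delta> powr (\<gamma> - 1) * (Sup I - Inf I)"
            using l \<gamma>_gt_1 by (intro mult_right_mono powr_mono2) auto
          finally show "(Sup I - Inf I) powr \<gamma> \<le> e / c * (Sup I - Inf I)"
            by (simp add: \<delta>)
        qed (use M_nonneg K_nonneg in simp)
        also have "\<dots> = M * K * (e / c) * (\<Sum>I\<in>P. Sup I - Inf I)"
          by (simp add: sum_distrib_left mult.assoc)
        also have "\<dots> = e * ((c - 1) / c)"
          using sum_division_telescope[OF P(1) st(2), of "\<lambda>x. x"] by (simp add: c_def)
        also have "\<dots> < e"
          using \<open>e > 0\<close> c by (simp add: field_simps)
        finally show ?thesis using nn by simp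
      qed
      then show "\<forall>\<^sub>F P in mesh_to_0 s t.
          dist (nrm V ((\<Sum>K\<in>P. \<Xi> (Sup K) (Inf K)) - (F t - F s))) 0 < e"
        unfolding eventually_mesh_to_0 using \<delta>(1) by blast
    qed
  qed
  show ?thesis
    using that[of F] Fcar Fle lim unfolding M_def ratio_def by blast
qed

end


section \<open>Convolution of a germ with the semigroup\<close>

lemma powr_mult_powr_le:
  fixes x y L :: real
  assumes "0 \<le> x" "0 \<le> y" "x \<le> L" "y \<le> L" "0 \<le> a" "0 \<le> b" "a + b = c"
  shows "x powr a * y powr b \<le> L powr c"
proof -
  have "x powr a * y powr b \<le> L powr a * L powr b"
    using assms by (intro mult_mono powr_mono2) auto
  then show ?thesis using assms(7) by (simp flip: powr_add)
qed

text \<open>The analytic content of a decomposition as in \<open>J_norm\<close> with all four seminorms bounded by the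
  real number \<open>N\<close>, together with the vanishing on the diagonal, which these bounds at distinct
  times do not imply.\<close>

definition J_germ ::
    "real \<Rightarrow> (real \<Rightarrow> 'a::real_vector nspace) \<Rightarrow> real \<Rightarrow> real \<Rightarrow> real \<Rightarrow> (real \<Rightarrow> real \<Rightarrow> 'a) \<Rightarrow> bool" where
  "J_germ \<alpha> V \<theta> T N f \<longleftrightarrow> 0 \<le> N \<and> (\<forall>u. 0 \<le> u \<and> u \<le> T \<longrightarrow> f u u = 0) \<and>
     (\<forall>u v. 0 \<le> u \<and> u < v \<and> v \<le> T \<longrightarrow>
       (\<exists>x\<in>car (V \<theta>). \<exists>y\<in>car (V (\<theta> - \<alpha>)). f v u = x + y \<and>
          nrm (V \<theta>) x \<le> N * (v - u) powr \<alpha> \<and>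
          nrm (V (\<theta> - \<alpha>)) y \<le> N * (v - u) powr (2 * \<alpha>))) \<and>
     (\<forall>u m v. 0 \<le> u \<and> u < m \<and> m < v \<and> v \<le> T \<longrightarrow>
       (\<exists>x\<in>car (V (\<theta> - 2 * \<alpha>)). \<exists>y\<in>car (V (\<theta> - 2 * \<alpha>)). delta2 f v m u = x + y \<and>
          nrm (V (\<theta> - 2 * \<alpha>)) x \<le> N * ((m - u) powr (2 * \<alpha>) * (v - m) powr \<alpha>) \<and>
          nrm (V (\<theta> - 2 * \<alpha>)) y \<le> N * ((m - u) powr \<alpha> * (v - m) powr (2 * \<alpha>))))"

sublocale interpolation_scale \<subseteq> sp: separable_banach "V \<theta>" for \<theta>
  by (rule banach)

context smoothing_semigroup
begin

definition convolved :: "(real \<Rightarrow> real \<Rightarrow> 'a) \<Rightarrow> real \<Rightarrow> real \<Rightarrow> real \<Rightarrow> 'a" where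
  "convolved f t v u = S (t - u) (f v u)"

lemma limitin_embedding:
  assumes "limitin (ntop (V \<theta>2)) f l F" "\<theta>1 \<le> \<theta>2"
  shows "limitin (ntop (V \<theta>1)) f l F"
  using continuous_map_limit[OF continuous_embedding[OF assms(2)] assms(1)] by (simp add: o_def)

lemma S_car: "0 \<le> t \<Longrightarrow> x \<in> car (V \<theta>) \<Longrightarrow> S t x \<in> car (V \<theta>)"
  using smoothing[of 0 t \<theta>] S_0[of x \<theta>] by (cases "t = 0") auto

lemma S_zero: "0 \<le> t \<Longrightarrow> S t 0 = 0"
  using S_scaleR[of t 0 0 0] sp.zero_car by simp

lemma S_diff:
  assumes "0 \<le> t" "x \<in> car (V \<theta>)" "y \<in> car (V \<theta>)"
  shows "S t (x - y) = S t x - S t y"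
  using S_add[OF assms(1,2) sp.scaleR_car[OF assms(3), of "-1"]] S_scaleR[OF assms(1,3), of "-1"]
  by simp

text \<open>The estimates for \<open>\<sigma> \<le> 1\<close> do not suffice, as \<open>\<beta>\<close> ranges up to \<open>3 \<alpha> \<le> 3/2\<close>. Half of the gain is
  taken over each half of the time.\<close>

lemma smoothing_2:
  assumes "0 \<le> \<sigma>" "\<sigma> \<le> 2"
  obtains C where "0 \<le> C" "\<And>t x. 0 < t \<Longrightarrow> t \<le> T \<Longrightarrow> x \<in> car (V \<theta>) \<Longrightarrow>
      S t x \<in> car (V (\<theta> + \<sigma>)) \<and> nrm (V (\<theta> + \<sigma>)) (S t x) \<le> C * t powr (- \<sigma>) * nrm (V \<theta>) x"
proof -
  have \<sigma>: "0 \<le> \<sigma> / 2" "\<sigma> / 2 \<le> 1" and e: "\<theta> + \<sigma> / 2 + \<sigma> / 2 = \<theta> + \<sigma>"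
    using assms by simp_all
  obtain C1 where C1: "\<forall>t\<in>{0<..T}. \<forall>x\<in>car (V \<theta>). S t x \<in> car (V (\<theta> + \<sigma> / 2)) \<and>
      nrm (V (\<theta> + \<sigma> / 2)) (S t x) \<le> C1 * t powr (- (\<sigma> / 2)) * nrm (V \<theta>) x"
    using smoothing[OF \<sigma>] by blast
  obtain C2 where C2: "\<forall>t\<in>{0<..T}. \<forall>x\<in>car (V (\<theta> + \<sigma> / 2)). S t x \<in> car (V (\<theta> + \<sigma>)) \<and>
      nrm (V (\<theta> + \<sigma>)) (S t x) \<le> C2 * t powr (- (\<sigma> / 2)) * nrm (V (\<theta> + \<sigma> / 2)) x"
    using smoothing[OF \<sigma>, of T "\<theta> + \<sigma> / 2"] unfolding e by blast
  show ?thesis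
  proof (rule that[of "\<bar>C2\<bar> * \<bar>C1\<bar> * 2 powr \<sigma>"])
    fix t x assume t: "0 < t" "t \<le> T" and x: "x \<in> car (V \<theta>)"
    define p where "p = (t / 2) powr (- (\<sigma> / 2))"
    have pp: "p * p = 2 powr \<sigma> * t powr (- \<sigma>)" and p: "0 \<le> p"
      using t by (auto simp: p_def powr_divide powr_minus field_simps simp flip: powr_add)
    have S: "S t x = S (t / 2) (S (t / 2) x)"
      using S_plus[of "t / 2" "t / 2" x \<theta>] t x by simp
    have 1: "S (t / 2) x \<in> car (V (\<theta> + \<sigma> / 2))"
      "nrm (V (\<theta> + \<sigma> / 2)) (S (t / 2) x) \<le> C1 * p * nrm (V \<theta>) x"
      using bspec[OF bspec[OF C1, of "t / 2"], of x] t x by (auto simp: p_def)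
    have 2: "S t x \<in> car (V (\<theta> + \<sigma>))"
      "nrm (V (\<theta> + \<sigma>)) (S t x) \<le> C2 * p * nrm (V (\<theta> + \<sigma> / 2)) (S (t / 2) x)"
      unfolding S using bspec[OF bspec[OF C2, of "t / 2"], OF _ 1(1)] t by (auto simp: p_def)
    note 2(2)
    also have "C2 * p * nrm (V (\<theta> + \<sigma> / 2)) (S (t / 2) x)
        \<le> \<bar>C2\<bar> * p * nrm (V (\<theta> + \<sigma> / 2)) (S (t / 2) x)"
      using p sp.nrm_nonneg[OF 1(1)] by (intro mult_right_mono) auto
    also have "\<dots> \<le> \<bar>C2\<bar> * p * (\<bar>C1\<bar> * p * nrm (V \<theta>) x)"
      using p sp.nrm_nonneg[OF x]
      by (intro mult_left_mono order_trans[OF 1(2)] mult_right_mono) auto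
    also have "\<dots> = \<bar>C2\<bar> * \<bar>C1\<bar> * (p * p) * nrm (V \<theta>) x" by simp
    finally show "S t x \<in> car (V (\<theta> + \<sigma>)) \<and> nrm (V (\<theta> + \<sigma>)) (S t x)
        \<le> \<bar>C2\<bar> * \<bar>C1\<bar> * 2 powr \<sigma> * t powr (- \<sigma>) * nrm (V \<theta>) x"
      using 2(1) unfolding pp by simp
  qed simp
qed

lemma time_regularity_nonneg:
  assumes "0 \<le> \<sigma>" "\<sigma> \<le> 1"
  obtains C where "0 \<le> C" "\<And>t x. 0 \<le> t \<Longrightarrow> t \<le> T \<Longrightarrow> x \<in> car (V (\<theta> + \<sigma>)) \<Longrightarrow>
      nrm (V \<theta>) (S t x - x) \<le> C * t powr \<sigma> * nrm (V (\<theta> + \<sigma>)) x"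
proof -
  obtain C where C: "\<forall>t\<in>{0..T}. \<forall>x\<in>car (V (\<theta> + \<sigma>)).
      nrm (V \<theta>) (S t x - x) \<le> C * t powr \<sigma> * nrm (V (\<theta> + \<sigma>)) x"
    using time_regularity[OF assms] by blast
  show ?thesis
  proof (rule that[of "\<bar>C\<bar>"])
    fix t x assume t: "0 \<le> t" "t \<le> T" and x: "x \<in> car (V (\<theta> + \<sigma>))"
    have "nrm (V \<theta>) (S t x - x) \<le> C * t powr \<sigma> * nrm (V (\<theta> + \<sigma>)) x"
      using C t x by auto
    also have "C * t powr \<sigma> * nrm (V (\<theta> + \<sigma>)) x \<le> \<bar>C\<bar> * t powr \<sigma> * nrm (V (\<theta> + \<sigma>)) x"
      using sp.nrm_nonneg[OF x] by (intro mult_right_mono) auto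
    finally show "nrm (V \<theta>) (S t x - x) \<le> \<bar>C\<bar> * t powr \<sigma> * nrm (V (\<theta> + \<sigma>)) x" .
  qed simp
qed

lemma J_germ_car:
  assumes "J_germ \<alpha> V \<theta> T N f" "0 \<le> \<alpha>" "0 \<le> u" "u \<le> v" "v \<le> T"
  shows "f v u \<in> car (V (\<theta> - 2 * \<alpha>))"
proof (cases "u = v")
  case True
  then show ?thesis using assms by (simp add: J_germ_def)
next
  case False
  then obtain x y where "f v u = x + y" "x \<in> car (V \<theta>)" "y \<in> car (V (\<theta> - \<alpha>))"
    using assms unfolding J_germ_def by (metis less_eq_real_def)
  then show ?thesis
    using car_mono[of "\<theta> - 2 * \<alpha>" \<theta>] car_mono[of "\<theta> - 2 * \<alpha>" "\<theta> - \<alpha>"] assms(2) by auto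
qed

lemma convolved_diagonal:
  assumes "J_germ \<alpha> V \<theta> T N f" "0 \<le> u" "u \<le> t" "t \<le> T"
  shows "convolved f t u u = 0"
  using assms by (auto simp: J_germ_def convolved_def S_zero)

text \<open>The semigroup spoils additivity by the extra term \<open>S (t - m) (S (m - u) - 1) f v m\<close>: there the
  regularity of \<open>f\<close> in space beyond \<open>\<theta> - 2 \<alpha>\<close> is traded for powers of \<open>m - u\<close>, which completes the
  Hoelder exponent to \<open>3 \<alpha>\<close> in both components of \<open>f\<close>. The outer factor \<open>S (t - m)\<close> gains \<open>\<beta>\<close>.\<close>

lemma convolved_delta2:
  assumes \<alpha>: "0 \<le> \<alpha>" "\<alpha> \<le> 1/2" and \<beta>: "0 \<le> \<beta>" "\<beta> \<le> 2"
  obtains C where "0 \<le> C" "\<And>f N t v m u. J_germ \<alpha> V \<theta> T N f \<Longrightarrow>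
      0 \<le> u \<Longrightarrow> u < m \<Longrightarrow> m < v \<Longrightarrow> v \<le> t \<Longrightarrow> t \<le> T \<Longrightarrow>
      delta2 (convolved f t) v m u \<in> car (V (\<theta> - 2 * \<alpha> + \<beta>)) \<and>
      nrm (V (\<theta> - 2 * \<alpha> + \<beta>)) (delta2 (convolved f t) v m u)
        \<le> C * N * (t - m) powr (- \<beta>) * (v - u) powr (3 * \<alpha>)"
proof -
  let ?W = "V (\<theta> - 2 * \<alpha>)" and ?U = "V (\<theta> - 2 * \<alpha> + \<beta>)"
  obtain C0 where C0: "0 \<le> C0" "\<And>t x. 0 < t \<Longrightarrow> t \<le> T \<Longrightarrow> x \<in> car ?W \<Longrightarrow>
      S t x \<in> car ?U \<and> nrm ?U (S t x) \<le> C0 * t powr (- \<beta>) * nrm ?W x"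
    using smoothing_2[OF \<beta>] by blast
  obtain C1 where C1: "0 \<le> C1" "\<And>t x. 0 \<le> t \<Longrightarrow> t \<le> T \<Longrightarrow> x \<in> car (V \<theta>) \<Longrightarrow>
      nrm ?W (S t x - x) \<le> C1 * t powr (2 * \<alpha>) * nrm (V \<theta>) x"
    using time_regularity_nonneg[of "2 * \<alpha>" T "\<theta> - 2 * \<alpha>"] \<alpha> by auto
  have e: "\<theta> - 2 * \<alpha> + \<alpha> = \<theta> - \<alpha>" by simp
  obtain C2 where C2: "0 \<le> C2" "\<And>t x. 0 \<le> t \<Longrightarrow> t \<le> T \<Longrightarrow> x \<in> car (V (\<theta> - \<alpha>)) \<Longrightarrow>
      nrm ?W (S t x - x) \<le> C2 * t powr \<alpha> * nrm (V (\<theta> - \<alpha>)) x"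
    using time_regularity_nonneg[of \<alpha> T "\<theta> - 2 * \<alpha>"] \<alpha> unfolding e by auto
  show ?thesis
  proof (rule that[of "C0 * (2 + C1 + C2)"])
    show "0 \<le> C0 * (2 + C1 + C2)" using C0 C1 C2 by simp
    fix f N t v m u
    assume f: "J_germ \<alpha> V \<theta> T N f" and u: "0 \<le> u" "u < m" "m < v" "v \<le> t" "t \<le> T"
    have N: "0 \<le> N" using f by (simp add: J_germ_def)
    have "0 \<le> m" "m \<le> T" "v \<le> T" using u by auto
    then obtain f1 f2 where
      f12: "f v m = f1 + f2" "f1 \<in> car (V \<theta>)" "f2 \<in> car (V (\<theta> - \<alpha>))"
        "nrm (V \<theta>) f1 \<le> N * (v - m) powr \<alpha>" "nrm (V (\<theta> - \<alpha>)) f2 \<le> N * (v - m) powr (2 * \<alpha>)"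
      using f u unfolding J_germ_def by meson
    obtain f3 f4 where
      f34: "delta2 f v m u = f3 + f4" "f3 \<in> car ?W" "f4 \<in> car ?W"
        "nrm ?W f3 \<le> N * ((m - u) powr (2 * \<alpha>) * (v - m) powr \<alpha>)"
        "nrm ?W f4 \<le> N * ((m - u) powr \<alpha> * (v - m) powr (2 * \<alpha>))"
      using f u \<open>v \<le> T\<close> unfolding J_germ_def by meson
    let ?L = "(v - u) powr (3 * \<alpha>)" and ?P = "(t - m) powr (- \<beta>)"
    have L1: "(m - u) powr (2 * \<alpha>) * (v - m) powr \<alpha> \<le> ?L"
      and L2: "(m - u) powr \<alpha> * (v - m) powr (2 * \<alpha>) \<le> ?L"
      using u \<alpha> by (auto intro!: powr_mult_powr_le)
    have f12W: "f1 \<in> car ?W" "f2 \<in> car ?W"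
      using f12 car_mono[of "\<theta> - 2 * \<alpha>" \<theta>] car_mono[of "\<theta> - 2 * \<alpha>" "\<theta> - \<alpha>"] \<alpha> by auto
    have fW: "f v m \<in> car ?W" "f v u \<in> car ?W" "f m u \<in> car ?W"
      using u by (auto intro!: J_germ_car[OF f] \<alpha>)
    define h where "h = (S (m - u) f1 - f1) + (S (m - u) f2 - f2)"
    have hW: "S (m - u) f1 - f1 \<in> car ?W" "S (m - u) f2 - f2 \<in> car ?W" "h \<in> car ?W"
      unfolding h_def using f12W u by (auto intro!: S_car sp.diff_car sp.add_car)
    have "nrm ?W (S (m - u) f1 - f1) \<le> C1 * N * ?L"
    proof -
      have "nrm ?W (S (m - u) f1 - f1) \<le> C1 * (m - u) powr (2 * \<alpha>) * (N * (v - m) powr \<alpha>)"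
        using u C1(1) f12 by (intro order_trans[OF C1(2)] mult_left_mono) auto
      also have "\<dots> = C1 * N * ((m - u) powr (2 * \<alpha>) * (v - m) powr \<alpha>)" by simp
      also have "\<dots> \<le> C1 * N * ?L" using C1(1) N L1 by (intro mult_left_mono) auto
      finally show ?thesis .
    qed
    moreover have "nrm ?W (S (m - u) f2 - f2) \<le> C2 * N * ?L"
    proof -
      have "nrm ?W (S (m - u) f2 - f2) \<le> C2 * (m - u) powr \<alpha> * (N * (v - m) powr (2 * \<alpha>))"
        using u C2(1) f12 by (intro order_trans[OF C2(2)] mult_left_mono) auto
      also have "\<dots> = C2 * N * ((m - u) powr \<alpha> * (v - m) powr (2 * \<alpha>))" by simp
      also have "\<dots> \<le> C2 * N * ?L" using C2(1) N L2 by (intro mult_left_mono) auto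
      finally show ?thesis .
    qed
    ultimately have h: "nrm ?W h \<le> (C1 + C2) * N * ?L"
      using sp.nrm_triangle[OF hW(1,2)] unfolding h_def by (simp add: algebra_simps)
    have d: "delta2 f v m u \<in> car ?W" "nrm ?W (delta2 f v m u) \<le> 2 * N * ?L"
    proof -
      show "delta2 f v m u \<in> car ?W" using f34 by auto
      have "nrm ?W f3 \<le> N * ?L" "nrm ?W f4 \<le> N * ?L"
        using f34(4,5) mult_left_mono[OF L1 N] mult_left_mono[OF L2 N] by linarith+
      then show "nrm ?W (delta2 f v m u) \<le> 2 * N * ?L"
        using sp.nrm_triangle[OF f34(2,3)] unfolding f34(1) by linarith
    qed
    have eq: "delta2 (convolved f t) v m u = S (t - u) (delta2 f v m u) + S (t - m) h"
    proof -
      have "S (t - u) (f v m) = S (t - m) (S (m - u) (f v m))"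
        using S_plus[of "t - m" "m - u" "f v m"] fW u by simp
      moreover have "h = S (m - u) (f v m) - f v m"
        using S_add[OF _ f12W, of "m - u"] u unfolding h_def f12(1) by simp
      moreover have "S (t - u) (delta2 f v m u) = S (t - u) (f v u) - S (t - u) (f v m) - S (t - u) (f m u)"
        unfolding delta2_def using fW u by (simp add: S_diff[where \<theta> = "\<theta> - 2 * \<alpha>"] sp.diff_car)
      moreover have "S (t - m) (S (m - u) (f v m) - f v m)
          = S (t - m) (S (m - u) (f v m)) - S (t - m) (f v m)"
        using fW u S_car[of "m - u" "f v m"] by (intro S_diff[where \<theta> = "\<theta> - 2 * \<alpha>"]) auto
      ultimately show ?thesis by (simp add: delta2_def convolved_def)
    qed
    have 1: "S (t - u) (delta2 f v m u) \<in> car ?U"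
      "nrm ?U (S (t - u) (delta2 f v m u)) \<le> C0 * ?P * (2 * N * ?L)"
    proof -
      show "S (t - u) (delta2 f v m u) \<in> car ?U" using C0(2) d u by auto
      have "nrm ?U (S (t - u) (delta2 f v m u)) \<le> C0 * (t - u) powr (- \<beta>) * nrm ?W (delta2 f v m u)"
        using C0(2) d u by auto
      also have "\<dots> \<le> C0 * ?P * (2 * N * ?L)"
        using u \<beta> C0(1) d N sp.nrm_nonneg[OF d(1)]
        by (intro mult_mono mult_left_mono powr_mono2') auto
      finally show "nrm ?U (S (t - u) (delta2 f v m u)) \<le> C0 * ?P * (2 * N * ?L)" .
    qed
    have 2: "S (t - m) h \<in> car ?U" "nrm ?U (S (t - m) h) \<le> C0 * ?P * ((C1 + C2) * N * ?L)"
    proof -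
      show "S (t - m) h \<in> car ?U" using C0(2) hW u by auto
      have "nrm ?U (S (t - m) h) \<le> C0 * ?P * nrm ?W h"
        using C0(2) hW u by auto
      also have "\<dots> \<le> C0 * ?P * ((C1 + C2) * N * ?L)"
        using C0(1) h by (intro mult_left_mono) auto
      finally show "nrm ?U (S (t - m) h) \<le> C0 * ?P * ((C1 + C2) * N * ?L)" .
    qed
    show "delta2 (convolved f t) v m u \<in> car ?U \<and>
      nrm ?U (delta2 (convolved f t) v m u) \<le> C0 * (2 + C1 + C2) * N * ?P * ?L"
      unfolding eq using 1 2 sp.nrm_triangle[OF 1(1) 2(1)]
      by (auto intro!: sp.add_car simp: algebra_simps)
  qed
qed

text \<open>The singular weight \<open>(t - m) powr - \<beta>\<close> is harmless in two situations: it is bounded on \<open>{a..b}\<close> if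
  \<open>b < t\<close>, and it is absent if \<open>\<beta> = 0\<close>. If two of the three times coincide, then \<open>delta2\<close> vanishes
  because the germ vanishes on the diagonal.\<close>

lemma almost_additive_convolved:
  assumes f: "J_germ \<alpha> V \<theta> T N f" and \<alpha>: "1/3 < \<alpha>" "\<alpha> \<le> 1/2" and \<beta>: "0 \<le> \<beta>" "\<beta> \<le> 2"
    and C: "0 \<le> C" "\<And>t v m u. 0 \<le> u \<Longrightarrow> u < m \<Longrightarrow> m < v \<Longrightarrow> v \<le> t \<Longrightarrow> t \<le> T \<Longrightarrow>
      nrm (V (\<theta> - 2 * \<alpha> + \<beta>)) (delta2 (convolved f t) v m u)
        \<le> C * N * (t - m) powr (- \<beta>) * (v - u) powr (3 * \<alpha>)"
    and t: "t \<le> T" and ab: "0 \<le> a" "b \<le> t" "b < t \<or> \<beta> = 0"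
    and K: "K = (if \<beta> = 0 then C * N else C * N * (t - b) powr (- \<beta>))"
  shows "almost_additive (V (\<theta> - 2 * \<alpha> + \<beta>)) (convolved f t) a b K (3 * \<alpha>)"
proof
  have N: "0 \<le> N" using f by (simp add: J_germ_def)
  show K0: "0 \<le> K" using C N by (simp add: K)
  show "1 < 3 * \<alpha>" using \<alpha> by simp
  show "convolved f t v u \<in> car (V (\<theta> - 2 * \<alpha> + \<beta>))" if "a \<le> u" "u \<le> v" "v \<le> b" for u v
  proof -
    have fc: "f v u \<in> car (V (\<theta> - 2 * \<alpha>))"
      using that ab t \<alpha> by (intro J_germ_car[OF f]) auto
    show ?thesis
    proof (cases "\<beta> = 0")
      case True
      then show ?thesis using S_car[OF _ fc] that ab by (simp add: convolved_def)
    next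
      case False
      show ?thesis
        using smoothing_2[OF \<beta>, of T "\<theta> - 2 * \<alpha>"] fc False that ab t
        unfolding convolved_def by (smt (verit, best))
    qed
  qed
  show "nrm (V (\<theta> - 2 * \<alpha> + \<beta>)) (delta2 (convolved f t) v m u) \<le> K * (v - u) powr (3 * \<alpha>)"
    if u: "a \<le> u" "u \<le> m" "m \<le> v" "v \<le> b" for u m v
  proof (cases "u < m \<and> m < v")
    case True
    then have "nrm (V (\<theta> - 2 * \<alpha> + \<beta>)) (delta2 (convolved f t) v m u)
        \<le> C * N * (t - m) powr (- \<beta>) * (v - u) powr (3 * \<alpha>)"
      using u ab t by (intro C) auto
    also have "\<dots> \<le> K * (v - u) powr (3 * \<alpha>)"
    proof (rule mult_right_mono)
      show "C * N * (t - m) powr (- \<beta>) \<le> K"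
        using ab u True \<beta> C(1) N unfolding K by (auto intro!: mult_left_mono powr_mono2')
    qed simp
    finally show ?thesis .
  next
    case False
    then have "delta2 (convolved f t) v m u = 0"
      using u ab t convolved_diagonal[OF f] by (auto simp: delta2_def)
    then show ?thesis using K0 by simp
  qed
qed

text \<open>For \<open>\<beta> > 0\<close> the factors \<open>(t - m) powr - \<beta>\<close> of the local errors are unbounded up to time \<open>t\<close>, so
  the sewing lemma does not apply on \<open>{s..t}\<close> in the smoother space. Instead \<open>{s..t}\<close> is cut
  at \<open>\<sigma> k = t - (t - s) / 2 ^ k\<close>. On \<open>{\<sigma> k..\<sigma> (Suc k)}\<close>, away from \<open>t\<close>, sewing in the smoother
  space gives an error of order \<open>((t - s) / 2 ^ k) powr (3 \<alpha> - \<beta>)\<close>, because the length of the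
  interval is comparable to its distance from \<open>t\<close>; a single application of \<open>delta2\<close> passes from
  the germ on \<open>{\<sigma> k..t}\<close> to those on the two parts. These errors are summable for all
  \<open>\<beta> < 3 \<alpha>\<close>, and the remainders on \<open>{\<sigma> k..t}\<close> vanish in the rougher space.\<close>

theorem rough_convolution_estimate:
  assumes \<alpha>: "1/3 < \<alpha>" "\<alpha> \<le> 1/2" and \<beta>: "0 \<le> \<beta>" "\<beta> < 3 * \<alpha>"
  obtains C where "0 \<le> C" "\<And>f N s t. J_germ \<alpha> V \<theta> T N f \<Longrightarrow> 0 \<le> s \<Longrightarrow> s \<le> t \<Longrightarrow> t \<le> T \<Longrightarrow>
      \<exists>z. has_rough_convolution (V (\<theta> - 2 * \<alpha>)) S f s t z \<and>
        z - S (t - s) (f t s) \<in> car (V (\<theta> - 2 * \<alpha> + \<beta>)) \<and>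
        nrm (V (\<theta> - 2 * \<alpha> + \<beta>)) (z - S (t - s) (f t s)) \<le> C * N * (t - s) powr (3 * \<alpha> - \<beta>)"
proof -
  let ?W = "V (\<theta> - 2 * \<alpha>)" and ?U = "V (\<theta> - 2 * \<alpha> + \<beta>)"
  define M where "M = 2 / (1 - 2 powr (1 - 3 * \<alpha>) :: real)"
  define q where "q = 2 powr (- (3 * \<alpha> - \<beta>))"
  have M: "0 \<le> M"
    using \<alpha> powr_less_mono[of "1 - 3 * \<alpha>" 0 2] by (simp add: M_def)
  have q: "0 \<le> q" "q < 1"
    using \<beta> powr_less_mono[of "- (3 * \<alpha> - \<beta>)" 0 2] by (auto simp: q_def)
  obtain C0 where C0: "0 \<le> C0" "\<And>f N t v m u. J_germ \<alpha> V \<theta> T N f \<Longrightarrow>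
      0 \<le> u \<Longrightarrow> u < m \<Longrightarrow> m < v \<Longrightarrow> v \<le> t \<Longrightarrow> t \<le> T \<Longrightarrow>
      delta2 (convolved f t) v m u \<in> car (V (\<theta> - 2 * \<alpha> + 0)) \<and>
      nrm (V (\<theta> - 2 * \<alpha> + 0)) (delta2 (convolved f t) v m u)
        \<le> C0 * N * (t - m) powr (- 0) * (v - u) powr (3 * \<alpha>)"
    using convolved_delta2[of \<alpha> 0 \<theta> T] \<alpha> by auto
  obtain C\<beta> where C\<beta>: "0 \<le> C\<beta>" "\<And>f N t v m u. J_germ \<alpha> V \<theta> T N f \<Longrightarrow>
      0 \<le> u \<Longrightarrow> u < m \<Longrightarrow> m < v \<Longrightarrow> v \<le> t \<Longrightarrow> t \<le> T \<Longrightarrow>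
      delta2 (convolved f t) v m u \<in> car ?U \<and>
      nrm ?U (delta2 (convolved f t) v m u)
        \<le> C\<beta> * N * (t - m) powr (- \<beta>) * (v - u) powr (3 * \<alpha>)"
    using convolved_delta2[of \<alpha> \<beta> \<theta> T] \<alpha> \<beta> by auto
  show ?thesis
  proof (rule that[of "(M + 1) * C\<beta> * 2 powr \<beta> / (1 - q)"])
    show "0 \<le> (M + 1) * C\<beta> * 2 powr \<beta> / (1 - q)" using M C\<beta>(1) q by simp
    fix f N s t
    assume f: "J_germ \<alpha> V \<theta> T N f" and st: "0 \<le> s" "s \<le> t" "t \<le> T"
    have N: "0 \<le> N" using f by (simp add: J_germ_def)
    let ?\<Xi> = "convolved f t"
    interpret A: almost_additive "V (\<theta> - 2 * \<alpha> + 0)" ?\<Xi> 0 t "C0 * N" "3 * \<alpha>"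
      using C0(2)[OF f] by (intro almost_additive_convolved[OF f \<alpha> _ _ C0(1)]) (use st in auto)
    obtain F where Fcar: "\<And>x. 0 \<le> x \<Longrightarrow> x \<le> t \<Longrightarrow> F x \<in> car ?W"
      and Fle: "\<And>a b. 0 \<le> a \<Longrightarrow> a \<le> b \<Longrightarrow> b \<le> t \<Longrightarrow>
             nrm ?W (F b - F a - ?\<Xi> b a) \<le> M * (C0 * N) * (b - a) powr (3 * \<alpha>)"
      and Flim: "\<And>a b. 0 \<le> a \<Longrightarrow> a \<le> b \<Longrightarrow> b \<le> t \<Longrightarrow>
             limitin (ntop ?W) (\<lambda>P. \<Sum>K\<in>P. ?\<Xi> (Sup K) (Inf K)) (F b - F a) (mesh_to_0 a b)"
      using A.sewing[folded M_def] st by auto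
    have conv: "has_rough_convolution ?W S f s t (F t - F s)"
      using Flim[of s t] st by (simp add: has_rough_convolution_def convolved_def)
    have cell: "F b - F a - ?\<Xi> b a \<in> car ?U \<and>
        nrm ?U (F b - F a - ?\<Xi> b a) \<le> M * (C\<beta> * N * (t - b) powr (- \<beta>)) * (b - a) powr (3 * \<alpha>)"
      if ab: "0 \<le> a" "a \<le> b" "b < t" for a b
    proof -
      \<comment> \<open>sewing in \<open>?U\<close> produces the same increment as sewing in \<open>?W\<close>, by uniqueness of the limit in \<open>?W\<close>\<close>
      interpret Ab: almost_additive ?U ?\<Xi> a b "C\<beta> * N * (t - b) powr (- \<beta>)" "3 * \<alpha>"
        using C\<beta>(2)[OF f] by (intro almost_additive_convolved[OF f \<alpha> _ _ C\<beta>(1)])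
          (use st ab \<alpha> \<beta> in \<open>auto simp: powr_zero_eq_one\<close>)
      obtain G where G: "\<And>x. a \<le> x \<Longrightarrow> x \<le> b \<Longrightarrow> G x \<in> car ?U"
        "nrm ?U (G b - G a - ?\<Xi> b a) \<le> M * (C\<beta> * N * (t - b) powr (- \<beta>)) * (b - a) powr (3 * \<alpha>)"
        "limitin (ntop ?U) (\<lambda>P. \<Sum>K\<in>P. ?\<Xi> (Sup K) (Inf K)) (G b - G a) (mesh_to_0 a b)"
        using Ab.sewing[folded M_def] ab by (smt (verit))
      have "limitin (ntop ?W) (\<lambda>P. \<Sum>K\<in>P. ?\<Xi> (Sup K) (Inf K)) (G b - G a) (mesh_to_0 a b)"
        using \<beta> by (intro limitin_embedding[OF G(3)]) auto
      then have "F b - F a = G b - G a"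
        using ab Flim[of a b] by (intro sp.limitin_unique[OF _ _ mesh_to_0_neq_bot]) auto
      then show ?thesis
        using G Ab.germ_car[of a b] ab by (auto intro!: sp.diff_car)
    qed
    show "\<exists>z. has_rough_convolution ?W S f s t z \<and> z - S (t - s) (f t s) \<in> car ?U \<and>
        nrm ?U (z - S (t - s) (f t s))
          \<le> (M + 1) * C\<beta> * 2 powr \<beta> / (1 - q) * N * (t - s) powr (3 * \<alpha> - \<beta>)"
    proof (cases "s = t")
      case True
      then have "S (t - s) (f t s) = 0"
        using f st by (simp add: J_germ_def S_zero)
      then show ?thesis using conv True by (intro exI[of _ "F t - F s"]) (simp add: sp.zero_car)
    next
      case False
      define h where "h = t - s"
      have h: "0 < h" using False st by (simp add: h_def)
      define \<sigma> where "\<sigma> k = t - h / 2 ^ k" for k :: nat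
      have \<sigma>: "0 \<le> \<sigma> k" "\<sigma> k < \<sigma> (Suc k)" "\<sigma> k < t" for k
      proof -
        have "h / 2 ^ k \<le> h / 1" using h by (intro divide_left_mono) auto
        then show "0 \<le> \<sigma> k" using st by (simp add: \<sigma>_def h_def)
      qed (use h in \<open>auto simp: \<sigma>_def field_simps\<close>)
      define D where "D k = F t - F (\<sigma> k) - ?\<Xi> t (\<sigma> k)" for k
      have step: "D k - D (Suc k) \<in> car ?U \<and>
          nrm ?U (D k - D (Suc k)) \<le> (M + 1) * C\<beta> * 2 powr \<beta> * N * h powr (3 * \<alpha> - \<beta>) * q ^ k" for k
      proof -
        let ?a = "\<sigma> k" and ?b = "\<sigma> (Suc k)" and ?L = "h / 2 ^ k"
        have tb: "t - ?b = ?L / 2" "?b - ?a = ?L / 2" "t - ?a = ?L"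
          by (simp_all add: \<sigma>_def field_simps)
        have L: "0 < ?L" using h by simp
        let ?P = "(?L / 2) powr (- \<beta>)"
        have 1: "F ?b - F ?a - ?\<Xi> ?b ?a \<in> car ?U"
          and le1: "nrm ?U (F ?b - F ?a - ?\<Xi> ?b ?a) \<le> M * (C\<beta> * N * ?P) * (?L / 2) powr (3 * \<alpha>)"
          using cell[of ?a ?b] \<sigma>[of k] \<sigma>(3)[of "Suc k"] unfolding tb by auto
        have 2: "delta2 ?\<Xi> t ?b ?a \<in> car ?U"
          and le2: "nrm ?U (delta2 ?\<Xi> t ?b ?a) \<le> C\<beta> * N * ?P * ?L powr (3 * \<alpha>)"
          using C\<beta>(2)[OF f, of ?a ?b t t] \<sigma>[of k] \<sigma>(3)[of "Suc k"] st unfolding tb by auto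
        have "(?L / 2) powr (3 * \<alpha>) \<le> ?L powr (3 * \<alpha>)"
          using L \<alpha> by (intro powr_mono2) auto
        then have "M * (C\<beta> * N * ?P) * (?L / 2) powr (3 * \<alpha>) \<le> M * (C\<beta> * N * ?P) * ?L powr (3 * \<alpha>)"
          using M C\<beta>(1) N by (intro mult_left_mono) auto
        then have "nrm ?U ((F ?b - F ?a - ?\<Xi> ?b ?a) - delta2 ?\<Xi> t ?b ?a)
            \<le> M * (C\<beta> * N * ?P) * ?L powr (3 * \<alpha>) + C\<beta> * N * ?P * ?L powr (3 * \<alpha>)"
          using sp.nrm_triangle_minus[OF 1 2] le1 le2 by linarith
        also have "\<dots> = (M + 1) * C\<beta> * N * (?P * ?L powr (3 * \<alpha>))"
          by (simp add: algebra_simps)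
        also have "?P * ?L powr (3 * \<alpha>) = 2 powr \<beta> * ?L powr (3 * \<alpha> - \<beta>)"
        proof -
          have "(x / 2) powr (- \<beta>) * x powr (3 * \<alpha>) = 2 powr \<beta> * x powr (3 * \<alpha> - \<beta>)" if "0 < x" for x
            using that by (simp add: powr_divide powr_minus powr_diff field_simps)
          then show ?thesis using L by blast
        qed
        also have "?L powr (3 * \<alpha> - \<beta>) = h powr (3 * \<alpha> - \<beta>) * q ^ k"
        proof -
          have "?L = h * 2 powr (- real k)"
            by (simp add: powr_minus powr_realpow divide_inverse)
          moreover have "q ^ k = 2 powr (- real k * (3 * \<alpha> - \<beta>))"
            by (simp add: q_def powr_power algebra_simps)
          ultimately show ?thesis using h by (simp add: powr_mult powr_powr)
        qed
        finally have "nrm ?U ((F ?b - F ?a - ?\<Xi> ?b ?a) - delta2 ?\<Xi> t ?b ?a)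
            \<le> (M + 1) * C\<beta> * 2 powr \<beta> * N * h powr (3 * \<alpha> - \<beta>) * q ^ k"
          by (simp add: mult_ac)
        moreover have "D k - D (Suc k) = (F ?b - F ?a - ?\<Xi> ?b ?a) - delta2 ?\<Xi> t ?b ?a"
          by (simp add: D_def delta2_def)
        ultimately show ?thesis using 1 2 by (simp add: sp.diff_car)
      qed
      have DW: "D k \<in> car ?W" for k
        using \<sigma>[of k] Fcar[of t] Fcar[of "\<sigma> k"] A.germ_car[of "\<sigma> k" t] st
        by (auto simp: D_def intro!: sp.diff_car)
      have D0: "D 0 - D n = (\<Sum>k<n. D k - D (Suc k))" for n
        by (rule sum_lessThan_telescope'[symmetric])
      obtain l where l: "limitin (ntop ?U) (\<lambda>n. D 0 - D n) l sequentially"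
        "nrm ?U (l - (D 0 - D 0)) \<le> (M + 1) * C\<beta> * 2 powr \<beta> * N * h powr (3 * \<alpha> - \<beta>) / (1 - q)"
      proof (rule sp.limitin_geometric[of "\<lambda>n. D 0 - D n" "\<theta> - 2 * \<alpha> + \<beta>" q
            "(M + 1) * C\<beta> * 2 powr \<beta> * N * h powr (3 * \<alpha> - \<beta>)"])
        show "D 0 - D n \<in> car ?U" for n
          unfolding D0 using step by (intro sp.sum_car) blast
        show "nrm ?U (D 0 - D (Suc n) - (D 0 - D n))
            \<le> (M + 1) * C\<beta> * 2 powr \<beta> * N * h powr (3 * \<alpha> - \<beta>) * q ^ n" for n
          using step[of n] by simp
      qed (use q in auto)
      have "limitin (ntop ?W) (\<lambda>n. D 0 - D n) (D 0 - 0) sequentially"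
      proof (rule sp.limitin_diff[OF sp.limitin_const[OF DW]])
        show "limitin (ntop ?W) D 0 sequentially"
          unfolding sp.limitin_iff
        proof (intro conjI)
          show "(\<lambda>n. nrm ?W (D n - 0)) \<longlonglongrightarrow> 0"
          proof (rule tendsto_sandwich[OF _ _ tendsto_const])
            show "\<forall>\<^sub>F n in sequentially. nrm ?W (D n - 0) \<le> M * (C0 * N) * (h / 2 ^ n) powr (3 * \<alpha>)"
              using Fle[of "\<sigma> n" t for n] \<sigma> st
              by (intro always_eventually allI) (simp add: D_def \<sigma>_def less_imp_le)
            have "(\<lambda>n. (h * (1 / 2) ^ n) powr (3 * \<alpha>)) \<longlonglongrightarrow> 0"
            proof (rule tendsto_zero_powrI[OF _ tendsto_const])
              have "(\<lambda>n. h * (1 / 2) ^ n) \<longlonglongrightarrow> h * 0"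
                by (intro tendsto_intros LIMSEQ_realpow_zero) auto
              then show "(\<lambda>n. h * (1 / 2) ^ n) \<longlonglongrightarrow> 0" by simp
            qed (use \<alpha> h in auto)
            then have "(\<lambda>n. M * (C0 * N) * (h * (1 / 2) ^ n) powr (3 * \<alpha>)) \<longlonglongrightarrow> M * (C0 * N) * 0"
              by (intro tendsto_intros)
            then show "(\<lambda>n. M * (C0 * N) * (h / 2 ^ n) powr (3 * \<alpha>)) \<longlonglongrightarrow> 0"
              unfolding power_one_over by (simp only: mult_zero_right times_divide_eq_right mult_1_right)
          qed (use DW sp.nrm_nonneg in auto)
        qed (use DW sp.zero_car in auto)
      qed
      moreover have "limitin (ntop ?W) (\<lambda>n. D 0 - D n) l sequentially"
        using \<beta> by (intro limitin_embedding[OF l(1)]) auto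
      ultimately have "l = D 0"
        using sp.limitin_unique[OF _ _ trivial_limit_sequentially] by fastforce
      moreover have "D 0 = F t - F s - S (t - s) (f t s)"
        by (simp add: D_def \<sigma>_def h_def convolved_def)
      moreover have "l \<in> car ?U" using l(1) by (simp add: sp.limitin_iff)
      ultimately show ?thesis
        using conv l(2) by (intro exI[of _ "F t - F s"]) (simp add: h_def mult_ac)
    qed
  qed
qed

end


section \<open>Seminorms and continuity\<close>

lemma hnorm2_leD:
  assumes "hnorm2 \<beta> I U f \<le> ennreal N" "0 \<le> N" "s \<in> I" "t \<in> I" "s < t"
  shows "nrm U (f t s) \<le> N * (t - s) powr \<beta>"
proof -
  have "ennreal (nrm U (f t s) / (t - s) powr \<beta>) \<le> hnorm2 \<beta> I U f"
    unfolding hnorm2_def using assms(3-) by (intro SUP_upper2[of "(t, s)"]) auto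
  also note assms(1)
  finally show ?thesis
    using assms by (simp add: divide_le_eq)
qed

lemma hnorm2_leI:
  assumes "\<And>s t. s \<in> I \<Longrightarrow> t \<in> I \<Longrightarrow> s < t \<Longrightarrow> nrm U (f t s) \<le> N * (t - s) powr \<beta>"
  shows "hnorm2 \<beta> I U f \<le> ennreal N"
  unfolding hnorm2_def using assms by (auto intro!: SUP_least ennreal_leI simp: divide_le_eq)

lemma hnorm3_leD:
  assumes "hnorm3 \<alpha>1 \<alpha>2 I U f \<le> ennreal N" "0 \<le> N" "s \<in> I" "u \<in> I" "t \<in> I" "s < u" "u < t"
  shows "nrm U (f t u s) \<le> N * ((u - s) powr \<alpha>1 * (t - u) powr \<alpha>2)"
proof -
  have "ennreal (nrm U (f t u s) / ((u - s) powr \<alpha>1 * (t - u) powr \<alpha>2)) \<le> hnorm3 \<alpha>1 \<alpha>2 I U f"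
    unfolding hnorm3_def using assms(3-) by (intro SUP_upper2[of "(t, u, s)"]) auto
  also note assms(1)
  finally show ?thesis
    using assms by (simp add: divide_le_eq)
qed

lemma hnorm3_leI:
  assumes "\<And>s u t. s \<in> I \<Longrightarrow> u \<in> I \<Longrightarrow> t \<in> I \<Longrightarrow> s < u \<Longrightarrow> u < t \<Longrightarrow>
      nrm U (f t u s) \<le> N * ((u - s) powr \<alpha>1 * (t - u) powr \<alpha>2)"
  shows "hnorm3 \<alpha>1 \<alpha>2 I U f \<le> ennreal N"
  unfolding hnorm3_def using assms by (auto intro!: SUP_least ennreal_leI simp: divide_le_eq)

lemma sup_norm_leD:
  assumes "sup_norm I U f \<le> ennreal N" "0 \<le> N" "t \<in> I"
  shows "nrm U (f t) \<le> N"
proof -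
  have "ennreal (nrm U (f t)) \<le> sup_norm I U f"
    unfolding sup_norm_def using assms(3) by (rule SUP_upper)
  also note assms(1)
  finally show ?thesis using assms(2) by simp
qed

lemma ntop_euclidean_nspace: "ntop (euclidean_nspace :: 'b::euclidean_space nspace) = euclidean"
proof -
  have "ndist (euclidean_nspace :: 'b nspace) = dist"
    by (simp add: fun_eq_iff ndist_def euclidean_nspace_def dist_norm)
  then show ?thesis by (simp add: ntop_def euclidean_nspace_def)
qed

lemma nrm_euclidean_nspace [simp]: "nrm euclidean_nspace = norm"
  by (simp add: euclidean_nspace_def)

context separable_banach
begin

lemma topspace_ntop [simp]: "topspace (ntop V) = car V"
  by (simp add: ntop_def)

lemma C1_car: "f \<in> C1 I V \<Longrightarrow> t \<in> I \<Longrightarrow> f t \<in> car V"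
  unfolding C1_def using continuous_map_image_subset_topspace by fastforce

lemma C2_car: "f \<in> C2 I V \<Longrightarrow> s \<in> I \<Longrightarrow> t \<in> I \<Longrightarrow> s \<le> t \<Longrightarrow> f t s \<in> car V"
  unfolding C2_def simplex2_def using continuous_map_image_subset_topspace by fastforce

lemma C3_car:
  "f \<in> C3 I V \<Longrightarrow> s \<in> I \<Longrightarrow> u \<in> I \<Longrightarrow> t \<in> I \<Longrightarrow> s \<le> u \<Longrightarrow> u \<le> t \<Longrightarrow> f t u s \<in> car V"
  unfolding C3_def simplex3_def using continuous_map_image_subset_topspace by fastforce

lemma sup_norm_finite:
  assumes f: "f \<in> C1 I V" and I: "compact I"
  shows "sup_norm I V f < \<infinity>"
proof -
  have "compactin mtopology (f ` I)"
    using f I image_compactin[of "top_of_set I" I mtopology f]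
    by (auto simp: C1_def ntop_def compactin_subtopology)
  then obtain c b where cb: "f ` I \<subseteq> mcball c b"
    using compactin_imp_mbounded unfolding mbounded_def by blast
  have "nrm V (f t) \<le> nrm V c + b" if "t \<in> I" for t
  proof -
    have "c \<in> car V" "f t \<in> car V" "nrm V (c - f t) \<le> b"
      using cb that by (auto simp: ndist_def split: if_splits)
    then show ?thesis
      using nrm_triangle_minus[of c "c - f t"] by (simp add: diff_car)
  qed
  then have "sup_norm I V f \<le> ennreal (nrm V c + b)"
    unfolding sup_norm_def by (intro SUP_least ennreal_leI)
  then show ?thesis by (simp add: order_le_less_trans)
qed

lemma continuous_map_scaleR:
  assumes "continuous_map T euclideanreal c" "continuous_map T (ntop V) f"
  shows "continuous_map T (ntop V) (\<lambda>x. c x *\<^sub>R f x)"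
  using assms unfolding continuous_map_atin by (auto intro: limitin_scaleR)

lemma continuous_map_add:
  assumes "continuous_map T (ntop V) f" "continuous_map T (ntop V) g"
  shows "continuous_map T (ntop V) (\<lambda>x. f x + g x)"
  using assms unfolding continuous_map_atin by (auto intro: limitin_add)

lemma continuous_map_diff:
  assumes "continuous_map T (ntop V) f" "continuous_map T (ntop V) g"
  shows "continuous_map T (ntop V) (\<lambda>x. f x - g x)"
  using assms unfolding continuous_map_atin by (auto intro: limitin_diff)

lemma continuous_map_uminus:
  assumes "continuous_map T (ntop V) f"
  shows "continuous_map T (ntop V) (\<lambda>x. - f x)"
  using continuous_map_scaleR[OF _ assms, of "\<lambda>_. - 1"] by simp

lemma continuous_map_sum:
  assumes "\<And>i. i \<in> A \<Longrightarrow> continuous_map T (ntop V) (f i)"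
  shows "continuous_map T (ntop V) (\<lambda>x. \<Sum>i\<in>A. f i x)"
  using assms unfolding continuous_map_atin by (auto intro: limitin_sum)

lemma continuous_map_C1:
  assumes "f \<in> C1 I V" "continuous_on A g" "g ` A \<subseteq> I"
  shows "continuous_map (top_of_set A) (ntop V) (\<lambda>x. f (g x))"
  using continuous_map_compose[of "top_of_set A" "top_of_set I" g "ntop V" f] assms
  by (auto simp: C1_def o_def)

lemma continuous_map_C2:
  assumes "f \<in> C2 I V" "continuous_on A g" "continuous_on A h"
    "\<And>x. x \<in> A \<Longrightarrow> g x \<in> I \<and> h x \<in> I \<and> h x \<le> g x"
  shows "continuous_map (top_of_set A) (ntop V) (\<lambda>x. f (g x) (h x))"
  using continuous_map_compose[of "top_of_set A" "top_of_set (simplex2 I)" "\<lambda>x. (g x, h x)"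
      "ntop V" "\<lambda>(t, s). f t s"] assms
  by (auto simp: C2_def o_def simplex2_def intro!: continuous_on_Pair)

lemma nrm_sum_scaleR_le:
  assumes "\<And>i. i \<in> A \<Longrightarrow> x i \<in> car V" "\<And>i. i \<in> A \<Longrightarrow> \<bar>c i\<bar> \<le> a"
    "\<And>i. i \<in> A \<Longrightarrow> nrm V (x i) \<le> b i" "0 \<le> a"
  shows "nrm V (\<Sum>i\<in>A. c i *\<^sub>R x i) \<le> a * (\<Sum>i\<in>A. b i)"
proof -
  have "nrm V (\<Sum>i\<in>A. c i *\<^sub>R x i) \<le> (\<Sum>i\<in>A. nrm V (c i *\<^sub>R x i))"
    using assms(1) by (intro nrm_sum scaleR_car)
  also have "\<dots> \<le> (\<Sum>i\<in>A. a * b i)"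
    using assms by (intro sum_mono) (auto simp: nrm_scaleR intro!: mult_mono nrm_nonneg)
  finally show ?thesis by (simp add: sum_distrib_left)
qed

lemma nrm_sum2_scaleR_le:
  assumes "\<And>i j. i \<in> A \<Longrightarrow> j \<in> B \<Longrightarrow> x i j \<in> car V" "\<And>i j. i \<in> A \<Longrightarrow> j \<in> B \<Longrightarrow> \<bar>c i j\<bar> \<le> a"
    "\<And>i j. i \<in> A \<Longrightarrow> j \<in> B \<Longrightarrow> nrm V (x i j) \<le> b i j" "0 \<le> a"
  shows "nrm V (\<Sum>i\<in>A. \<Sum>j\<in>B. c i j *\<^sub>R x i j) \<le> a * (\<Sum>i\<in>A. \<Sum>j\<in>B. b i j)"
proof -
  have "nrm V (\<Sum>i\<in>A. \<Sum>j\<in>B. c i j *\<^sub>R x i j) \<le> (\<Sum>i\<in>A. nrm V (\<Sum>j\<in>B. c i j *\<^sub>R x i j))"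
    using assms(1) by (intro nrm_sum sum_car scaleR_car)
  also have "\<dots> \<le> (\<Sum>i\<in>A. a * (\<Sum>j\<in>B. b i j))"
    using assms by (intro sum_mono nrm_sum_scaleR_le) auto
  finally show ?thesis by (simp add: sum_distrib_left)
qed

end


lemma matrix_component_le_norm: "\<bar>A $ i $ j\<bar> \<le> norm (A :: real ^ 'm ^ 'n)"
  using component_le_norm_cart[of "A $ i" j] Finite_Cartesian_Product.norm_nth_le[of A i] by linarith


section \<open>The rough convolution of a germ with finite norm\<close>

lemma (in interpolation_scale) J_germ_of_decomposition:
  assumes d: "(f1, f2, f3, f4) \<in> J_decompositions \<alpha> V \<theta> {0..T} f"
    and 0: "\<And>u. 0 \<le> u \<Longrightarrow> u \<le> T \<Longrightarrow> f u u = 0"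
    and N: "N = hnorm2 \<alpha> {0..T} (V \<theta>) f1 + hnorm2 (2 * \<alpha>) {0..T} (V (\<theta> - \<alpha>)) f2 +
     hnorm3 (2 * \<alpha>) \<alpha> {0..T} (V (\<theta> - 2 * \<alpha>)) f3 + hnorm3 \<alpha> (2 * \<alpha>) {0..T} (V (\<theta> - 2 * \<alpha>)) f4"
  shows "N = ennreal (enn2real N)" "J_germ \<alpha> V \<theta> T (enn2real N) f"
proof -
  have f: "f1 \<in> C2 {0..T} (V \<theta>)" "f2 \<in> C2 {0..T} (V (\<theta> - \<alpha>))"
    "f3 \<in> C3 {0..T} (V (\<theta> - 2 * \<alpha>))" "f4 \<in> C3 {0..T} (V (\<theta> - 2 * \<alpha>))"
    "\<And>t s. (t, s) \<in> simplex2 {0..T} \<Longrightarrow> f t s = f1 t s + f2 t s"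
    "\<And>t u s. (t, u, s) \<in> simplex3 {0..T} \<Longrightarrow> delta2 f t u s = f3 t u s + f4 t u s"
    and "N < \<infinity>"
    using d unfolding N J_decompositions_def C2_hoelder_def C3_hoelder_def by auto
  then show e: "N = ennreal (enn2real N)" by simp
  have le: "hnorm2 \<alpha> {0..T} (V \<theta>) f1 \<le> ennreal (enn2real N)"
    "hnorm2 (2 * \<alpha>) {0..T} (V (\<theta> - \<alpha>)) f2 \<le> ennreal (enn2real N)"
    "hnorm3 (2 * \<alpha>) \<alpha> {0..T} (V (\<theta> - 2 * \<alpha>)) f3 \<le> ennreal (enn2real N)"
    "hnorm3 \<alpha> (2 * \<alpha>) {0..T} (V (\<theta> - 2 * \<alpha>)) f4 \<le> ennreal (enn2real N)"
    unfolding e[symmetric] unfolding N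
    by (auto intro: add_increasing add_increasing2 simp: add.assoc)
  have nn: "0 \<le> enn2real N" by simp
  show "J_germ \<alpha> V \<theta> T (enn2real N) f"
    unfolding J_germ_def
  proof (intro conjI allI impI; (elim conjE)?)
    fix u v assume u: "0 \<le> u" "u < v" "v \<le> T"
    then show "\<exists>x\<in>car (V \<theta>). \<exists>y\<in>car (V (\<theta> - \<alpha>)). f v u = x + y \<and>
          nrm (V \<theta>) x \<le> enn2real N * (v - u) powr \<alpha> \<and>
          nrm (V (\<theta> - \<alpha>)) y \<le> enn2real N * (v - u) powr (2 * \<alpha>)"
      using f(5)[of v u]
      by (intro bexI[of _ "f1 v u"] bexI[of _ "f2 v u"] conjI hnorm2_leD[OF le(1) nn]
          hnorm2_leD[OF le(2) nn] sp.C2_car[OF f(1)] sp.C2_car[OF f(2)]) (auto simp: simplex2_def)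
  next
    fix u m v assume u: "0 \<le> u" "u < m" "m < v" "v \<le> T"
    then show "\<exists>x\<in>car (V (\<theta> - 2 * \<alpha>)). \<exists>y\<in>car (V (\<theta> - 2 * \<alpha>)). delta2 f v m u = x + y \<and>
          nrm (V (\<theta> - 2 * \<alpha>)) x \<le> enn2real N * ((m - u) powr (2 * \<alpha>) * (v - m) powr \<alpha>) \<and>
          nrm (V (\<theta> - 2 * \<alpha>)) y \<le> enn2real N * ((m - u) powr \<alpha> * (v - m) powr (2 * \<alpha>))"
      using f(6)[of v m u]
      by (intro bexI[of _ "f3 v m u"] bexI[of _ "f4 v m u"] conjI hnorm3_leD[OF le(3) nn]
          hnorm3_leD[OF le(4) nn] sp.C3_car[OF f(3)] sp.C3_car[OF f(4)]) (auto simp: simplex3_def)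
  qed (use nn 0 in auto)
qed

text \<open>The form in which the infimum in \<open>J_norm\<close> is taken: a bound by every finite norm sum of a
  decomposition, with a constant that does not depend on the decomposition.\<close>

lemma ennreal_le_mult_INF:
  assumes "0 \<le> c" "A \<noteq> {}"
    and "\<And>d. d \<in> A \<Longrightarrow> N d = ennreal (enn2real (N d)) \<and> x \<le> c * enn2real (N d)"
  shows "ennreal x \<le> ennreal c * (INF d\<in>A. N d)"
proof (cases "c = 0")
  case True
  obtain d where "d \<in> A" using assms(2) by blast
  then show ?thesis using assms(3)[of d] True by (simp add: ennreal_neg)
next
  case False
  have "ennreal (x / c) \<le> (INF d\<in>A. N d)"
  proof (rule INF_greatest)
    fix d assume "d \<in> A"
    then have "x / c \<le> enn2real (N d)" and e: "N d = ennreal (enn2real (N d))"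
      using assms False by (auto simp: field_simps)
    then show "ennreal (x / c) \<le> N d" by (metis ennreal_leI)
  qed
  then have "ennreal c * ennreal (x / c) \<le> ennreal c * (INF d\<in>A. N d)"
    by (rule mult_left_mono) simp
  then show ?thesis using assms(1) False by (simp flip: ennreal_mult')
qed

text \<open>The value of the limit does not depend on the decomposition of \<open>f\<close>, while the estimate holds for
  each decomposition with the same \<open>C\<close>; hence it holds for the infimum.\<close>

theorem (in smoothing_semigroup) rough_convolution_J_norm:
  assumes \<alpha>: "1/3 < \<alpha>" "\<alpha> \<le> 1/2" and \<beta>: "0 \<le> \<beta>" "\<beta> < 3 * \<alpha>"
  obtains C where "\<And>f s t. (\<And>u. 0 \<le> u \<Longrightarrow> u \<le> T \<Longrightarrow> f u u = 0) \<Longrightarrow>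
      J_decompositions \<alpha> V \<theta> {0..T} f \<noteq> {} \<Longrightarrow> 0 \<le> s \<Longrightarrow> s \<le> t \<Longrightarrow> t \<le> T \<Longrightarrow>
      has_rough_convolution (V (\<theta> - 2 * \<alpha>)) S f s t (rough_convolution (V (\<theta> - 2 * \<alpha>)) S f s t) \<and>
      rough_convolution (V (\<theta> - 2 * \<alpha>)) S f s t - S (t - s) (f t s) \<in> car (V (\<theta> - 2 * \<alpha> + \<beta>)) \<and>
      ennreal (nrm (V (\<theta> - 2 * \<alpha> + \<beta>))
          (rough_convolution (V (\<theta> - 2 * \<alpha>)) S f s t - S (t - s) (f t s)))
        \<le> ennreal C * J_norm \<alpha> V \<theta> {0..T} f * ennreal ((t - s) powr (3 * \<alpha> - \<beta>))"
proof -
  let ?W = "V (\<theta> - 2 * \<alpha>)" and ?U = "V (\<theta> - 2 * \<alpha> + \<beta>)"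
  obtain C where C: "0 \<le> C" "\<And>f N s t. J_germ \<alpha> V \<theta> T N f \<Longrightarrow> 0 \<le> s \<Longrightarrow> s \<le> t \<Longrightarrow> t \<le> T \<Longrightarrow>
      \<exists>z. has_rough_convolution ?W S f s t z \<and> z - S (t - s) (f t s) \<in> car ?U \<and>
        nrm ?U (z - S (t - s) (f t s)) \<le> C * N * (t - s) powr (3 * \<alpha> - \<beta>)"
    using rough_convolution_estimate[OF \<alpha> \<beta>, of \<theta> T] by metis
  show ?thesis
  proof (rule that[of C])
    fix f s t
    assume diag: "\<And>u. 0 \<le> u \<Longrightarrow> u \<le> T \<Longrightarrow> f u u = 0"
      and ne: "J_decompositions \<alpha> V \<theta> {0..T} f \<noteq> {}" and st: "0 \<le> s" "s \<le> t" "t \<le> T"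
    define z where "z = rough_convolution ?W S f s t"
    define A where "A = J_decompositions \<alpha> V \<theta> {0..T} f"
    define N where "N d = (case d of (f1, f2, f3, f4) \<Rightarrow>
      hnorm2 \<alpha> {0..T} (V \<theta>) f1 + hnorm2 (2 * \<alpha>) {0..T} (V (\<theta> - \<alpha>)) f2 +
      hnorm3 (2 * \<alpha>) \<alpha> {0..T} ?W f3 + hnorm3 \<alpha> (2 * \<alpha>) {0..T} ?W f4)" for d
    have J: "J_norm \<alpha> V \<theta> {0..T} f = (INF d\<in>A. N d)"
      unfolding J_norm_def A_def N_def ..
    have z: "z = w" if "has_rough_convolution ?W S f s t w" for w
      unfolding z_def rough_convolution_def
    proof (rule the_equality)
      show "has_rough_convolution ?W S f s t w" by (rule that)
      fix x assume "has_rough_convolution ?W S f s t x"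
      then show "x = w"
        using that unfolding has_rough_convolution_def
        by (rule sp.limitin_unique[OF _ _ mesh_to_0_neq_bot])
    qed
    have dec: "has_rough_convolution ?W S f s t z \<and> z - S (t - s) (f t s) \<in> car ?U \<and>
        N d = ennreal (enn2real (N d)) \<and>
        nrm ?U (z - S (t - s) (f t s)) \<le> C * (t - s) powr (3 * \<alpha> - \<beta>) * enn2real (N d)"
      if "d \<in> A" for d
    proof -
      obtain f1 f2 f3 f4 where d: "d = (f1, f2, f3, f4)" by (cases d)
      have fd: "(f1, f2, f3, f4) \<in> J_decompositions \<alpha> V \<theta> {0..T} f"
        using that by (simp add: d A_def)
      have Nd: "N d = ennreal (enn2real (N d))" "J_germ \<alpha> V \<theta> T (enn2real (N d)) f"
        using J_germ_of_decomposition[OF fd _ refl] diag by (auto simp: d N_def)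
      show ?thesis
        using C(2)[OF Nd(2) st] Nd(1) z by (auto simp: mult_ac)
    qed
    have "A \<noteq> {}" using ne by (simp add: A_def)
    then obtain d where "d \<in> A" by blast
    have "ennreal (nrm ?U (z - S (t - s) (f t s)))
        \<le> ennreal (C * (t - s) powr (3 * \<alpha> - \<beta>)) * J_norm \<alpha> V \<theta> {0..T} f"
      unfolding J using C(1) \<open>A \<noteq> {}\<close> dec by (intro ennreal_le_mult_INF) auto
    also have "\<dots> = ennreal C * J_norm \<alpha> V \<theta> {0..T} f * ennreal ((t - s) powr (3 * \<alpha> - \<beta>))"
      using C(1) by (simp add: ennreal_mult mult_ac)
    finally show "has_rough_convolution ?W S f s t (rough_convolution ?W S f s t) \<and>
         rough_convolution ?W S f s t - S (t - s) (f t s) \<in> car ?U \<and>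
         ennreal (nrm ?U (rough_convolution ?W S f s t - S (t - s) (f t s)))
           \<le> ennreal C * J_norm \<alpha> V \<theta> {0..T} f * ennreal ((t - s) powr (3 * \<alpha> - \<beta>))"
      using dec[OF \<open>d \<in> A\<close>] unfolding z_def by blast
  qed
qed


section \<open>The germ of a delayed controlled path\<close>

locale delayed_germ = interpolation_scale V for V :: "real \<Rightarrow> 'a::real_vector nspace" +
  fixes \<alpha> \<theta> r T :: real and X :: "real \<Rightarrow> real ^ 'd" and XX Xr :: "real \<Rightarrow> real \<Rightarrow> real ^ 'd ^ 'd"
    and y :: "'d \<Rightarrow> real \<Rightarrow> 'a" and y' yr :: "'d \<Rightarrow> 'd \<Rightarrow> real \<Rightarrow> 'a"
  assumes rough: "delayed_rough_path \<alpha> r {0..T} X XX Xr"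
    and controlled: "delayed_controlled_path \<alpha> r V \<theta> {0..T} X (y i) (y' i) (yr i)"
begin

abbreviation I :: "real set" where "I \<equiv> {0..T}"
abbreviation D :: "real set" where "D \<equiv> delay_domain r I"

lemma I_subset_D: "I \<subseteq> D"
  by (auto simp: delay_domain_def)

lemma continuous_XD: "continuous_on D X" "continuous_on (simplex2 D) (\<lambda>(t, s). XX t s)"
    "continuous_on (simplex2 I) (\<lambda>(t, s). Xr t s)"
  using rough unfolding delayed_rough_path_def C1_hoelder_def C2_hoelder_def C1_def C2_def
  by (auto simp: ntop_euclidean_nspace)

lemma X_hnorm_finite: "hnorm2 \<alpha> D euclidean_nspace (delta1 X) < \<infinity>"
    "hnorm2 (2 * \<alpha>) D euclidean_nspace XX < \<infinity>" "hnorm2 (2 * \<alpha>) I euclidean_nspace Xr < \<infinity>"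
  using rough unfolding delayed_rough_path_def C1_hoelder_def C2_hoelder_def by auto

lemma chen:
  assumes "(v, m, u) \<in> simplex3 I"
  shows "XX v u $ j $ i = XX m u $ j $ i + XX v m $ j $ i + delta1 X m u $ j * delta1 X v m $ i"
    "Xr v u $ j $ i = Xr m u $ j $ i + Xr v m $ j $ i + delta1 X (m - r) (u - r) $ j * delta1 X v m $ i"
  using rough assms unfolding delayed_rough_path_def by (fastforce simp: algebra_simps)+

lemma y_C1: "y i \<in> C1 I (V \<theta>)" "y' i j \<in> C1 I (V (\<theta> - \<alpha>))" "yr i j \<in> C1 I (V (\<theta> - \<alpha>))"
    "y' i j \<in> C1 I (V (\<theta> - 2 * \<alpha>))" "yr i j \<in> C1 I (V (\<theta> - 2 * \<alpha>))"
    "hnorm2 \<alpha> I (V (\<theta> - 2 * \<alpha>)) (delta1 (y' i j)) < \<infinity>"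
    "hnorm2 \<alpha> I (V (\<theta> - 2 * \<alpha>)) (delta1 (yr i j)) < \<infinity>"
    "remainder r X (y i) (y' i) (yr i) \<in> C2 I (V (\<theta> - 2 * \<alpha>))"
    "hnorm2 (2 * \<alpha>) I (V (\<theta> - 2 * \<alpha>)) (remainder r X (y i) (y' i) (yr i)) < \<infinity>"
  using controlled[of i] unfolding delayed_controlled_path_def C1_hoelder_def C2_hoelder_def by auto

lemma germ_diagonal:
  assumes "u \<in> I"
  shows "germ X XX Xr y y' yr u u = 0"
proof -
  have "(u, u, u) \<in> simplex3 I" using assms by (simp add: simplex3_def)
  then show ?thesis
    using chen[of u u u] by (simp add: germ_def delta1_def)
qed

definition f1 :: "real \<Rightarrow> real \<Rightarrow> 'a" where
  "f1 v u = (\<Sum>i\<in>UNIV. (delta1 X v u $ i) *\<^sub>R y i u)"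

definition f2 :: "real \<Rightarrow> real \<Rightarrow> 'a" where
  "f2 v u = (\<Sum>i\<in>UNIV. \<Sum>j\<in>UNIV. (XX v u $ j $ i) *\<^sub>R y' i j u) +
            (\<Sum>i\<in>UNIV. \<Sum>j\<in>UNIV. (Xr v u $ j $ i) *\<^sub>R yr i j u)"

definition f3 :: "real \<Rightarrow> real \<Rightarrow> real \<Rightarrow> 'a" where
  "f3 v m u = - (\<Sum>i\<in>UNIV. (delta1 X v m $ i) *\<^sub>R remainder r X (y i) (y' i) (yr i) m u)"

definition f4 :: "real \<Rightarrow> real \<Rightarrow> real \<Rightarrow> 'a" where
  "f4 v m u = - ((\<Sum>i\<in>UNIV. \<Sum>j\<in>UNIV. (XX v m $ j $ i) *\<^sub>R delta1 (y' i j) m u) +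
                 (\<Sum>i\<in>UNIV. \<Sum>j\<in>UNIV. (Xr v m $ j $ i) *\<^sub>R delta1 (yr i j) m u))"

lemma germ_eq: "germ X XX Xr y y' yr v u = f1 v u + f2 v u"
  by (simp add: germ_def f1_def f2_def)

text \<open>The expansion of \<open>delta1 y\<close> in terms of \<open>y'\<close>, \<open>yr\<close> and the remainder produces products of two
  increments of \<open>X\<close>. By Chen's relations they cancel against those produced by \<open>XX\<close> and \<open>Xr\<close>, so
  that only the remainder and the increments of the Gubinelli derivatives are left.\<close>

lemma delta2_germ:
  assumes "(v, m, u) \<in> simplex3 I"
  shows "delta2 (germ X XX Xr y y' yr) v m u = f3 v m u + f4 v m u"
proof -
  have "delta2 (germ X XX Xr y y' yr) v m u
      = (\<Sum>i\<in>UNIV. ((delta1 X v u $ i) *\<^sub>R y i u - (delta1 X v m $ i) *\<^sub>R y i m - (delta1 X m u $ i) *\<^sub>R y i u)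
         + (\<Sum>j\<in>UNIV. (XX v u $ j $ i) *\<^sub>R y' i j u - (XX v m $ j $ i) *\<^sub>R y' i j m - (XX m u $ j $ i) *\<^sub>R y' i j u)
         + (\<Sum>j\<in>UNIV. (Xr v u $ j $ i) *\<^sub>R yr i j u - (Xr v m $ j $ i) *\<^sub>R yr i j m - (Xr m u $ j $ i) *\<^sub>R yr i j u))"
    by (simp add: delta2_def germ_def sum.distrib sum_subtractf)
  also have "\<dots> = (\<Sum>i\<in>UNIV. - ((delta1 X v m $ i) *\<^sub>R remainder r X (y i) (y' i) (yr i) m u)
         - (\<Sum>j\<in>UNIV. (XX v m $ j $ i) *\<^sub>R delta1 (y' i j) m u)
         - (\<Sum>j\<in>UNIV. (Xr v m $ j $ i) *\<^sub>R delta1 (yr i j) m u))"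
  proof (rule sum.cong[OF refl])
    fix i
    let ?x = "delta1 X v m $ i"
    have 1: "(delta1 X v u $ i) *\<^sub>R y i u - ?x *\<^sub>R y i m - (delta1 X m u $ i) *\<^sub>R y i u
        = - (?x *\<^sub>R delta1 (y i) m u)"
      by (simp add: delta1_def algebra_simps)
    have 2: "(\<Sum>j\<in>UNIV. (XX v u $ j $ i) *\<^sub>R y' i j u - (XX v m $ j $ i) *\<^sub>R y' i j m - (XX m u $ j $ i) *\<^sub>R y' i j u)
        = ?x *\<^sub>R (\<Sum>j\<in>UNIV. (delta1 X m u $ j) *\<^sub>R y' i j u)
          - (\<Sum>j\<in>UNIV. (XX v m $ j $ i) *\<^sub>R delta1 (y' i j) m u)"
      unfolding chen(1)[OF assms] delta1_def[of "y' i j" for j] scaleR_sum_right sum_subtractf[symmetric]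
      by (intro sum.cong) (simp_all add: algebra_simps)
    have 3: "(\<Sum>j\<in>UNIV. (Xr v u $ j $ i) *\<^sub>R yr i j u - (Xr v m $ j $ i) *\<^sub>R yr i j m - (Xr m u $ j $ i) *\<^sub>R yr i j u)
        = ?x *\<^sub>R (\<Sum>j\<in>UNIV. (delta1 X (m - r) (u - r) $ j) *\<^sub>R yr i j u)
          - (\<Sum>j\<in>UNIV. (Xr v m $ j $ i) *\<^sub>R delta1 (yr i j) m u)"
      unfolding chen(2)[OF assms] delta1_def[of "yr i j" for j] scaleR_sum_right sum_subtractf[symmetric]
      by (intro sum.cong) (simp_all add: algebra_simps)
    show "((delta1 X v u $ i) *\<^sub>R y i u - (delta1 X v m $ i) *\<^sub>R y i m - (delta1 X m u $ i) *\<^sub>R y i u)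
         + (\<Sum>j\<in>UNIV. (XX v u $ j $ i) *\<^sub>R y' i j u - (XX v m $ j $ i) *\<^sub>R y' i j m - (XX m u $ j $ i) *\<^sub>R y' i j u)
         + (\<Sum>j\<in>UNIV. (Xr v u $ j $ i) *\<^sub>R yr i j u - (Xr v m $ j $ i) *\<^sub>R yr i j m - (Xr m u $ j $ i) *\<^sub>R yr i j u)
       = - ((delta1 X v m $ i) *\<^sub>R remainder r X (y i) (y' i) (yr i) m u)
         - (\<Sum>j\<in>UNIV. (XX v m $ j $ i) *\<^sub>R delta1 (y' i j) m u)
         - (\<Sum>j\<in>UNIV. (Xr v m $ j $ i) *\<^sub>R delta1 (yr i j) m u)"
      unfolding 1 2 3 remainder_def by (simp add: scaleR_diff_right)
  qed
  also have "\<dots> = f3 v m u + f4 v m u"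
    by (simp add: f3_def f4_def sum_subtractf sum_negf)
  finally show ?thesis .
qed

lemma continuous_f:
  "f1 \<in> C2 I (V \<theta>)" "f2 \<in> C2 I (V (\<theta> - \<alpha>))"
  "f3 \<in> C3 I (V (\<theta> - 2 * \<alpha>))" "f4 \<in> C3 I (V (\<theta> - 2 * \<alpha>))"
proof -
  have X: "continuous_on A (\<lambda>x. X (g x))" if "continuous_on A g" "g ` A \<subseteq> I" for A :: "'p::topological_space set" and g
    using continuous_on_compose2[OF continuous_XD(1) that(1)] that(2) I_subset_D by blast
  have XX: "continuous_on A (\<lambda>x. XX (g x) (h x))" "continuous_on A (\<lambda>x. Xr (g x) (h x))"
    if "continuous_on A g" "continuous_on A h" "\<And>x. x \<in> A \<Longrightarrow> g x \<in> I \<and> h x \<in> I \<and> h x \<le> g x"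
    for A :: "'p::topological_space set" and g h
    using continuous_on_compose2[OF continuous_XD(2) continuous_on_Pair[OF that(1,2)]]
      continuous_on_compose2[OF continuous_XD(3) continuous_on_Pair[OF that(1,2)]]
      that(3) I_subset_D by (auto simp: simplex2_def image_subset_iff subset_eq)
  show "f1 \<in> C2 I (V \<theta>)"
    unfolding C2_def mem_Collect_eq f1_def case_prod_unfold delta1_def
    by (intro sp.continuous_map_sum sp.continuous_map_scaleR sp.continuous_map_C1[OF y_C1(1)])
       (auto intro!: continuous_intros X simp: simplex2_def)
  show "f2 \<in> C2 I (V (\<theta> - \<alpha>))"
    unfolding C2_def mem_Collect_eq f2_def case_prod_unfold delta1_def
    by (intro sp.continuous_map_sum sp.continuous_map_add sp.continuous_map_scaleR
          sp.continuous_map_C1[OF y_C1(2)] sp.continuous_map_C1[OF y_C1(3)])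
       (auto intro!: continuous_intros XX simp: simplex2_def)
  show "f3 \<in> C3 I (V (\<theta> - 2 * \<alpha>))"
    unfolding C3_def mem_Collect_eq f3_def case_prod_unfold delta1_def
    by (intro sp.continuous_map_sum sp.continuous_map_uminus sp.continuous_map_scaleR
          sp.continuous_map_C2[OF y_C1(8)])
       (auto intro!: continuous_intros X simp: simplex3_def)
  show "f4 \<in> C3 I (V (\<theta> - 2 * \<alpha>))"
    unfolding C3_def mem_Collect_eq f4_def case_prod_unfold delta1_def
    by (intro sp.continuous_map_sum sp.continuous_map_uminus sp.continuous_map_add sp.continuous_map_diff
          sp.continuous_map_scaleR sp.continuous_map_C1[OF y_C1(4)] sp.continuous_map_C1[OF y_C1(5)])
       (auto intro!: continuous_intros XX simp: simplex3_def)
qed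

text \<open>Every summand of \<open>f1\<close>, \<open>f2\<close>, \<open>f3\<close> and \<open>f4\<close> is a component of \<open>X\<close>, \<open>XX\<close> or \<open>Xr\<close> times a vector
  controlled by exactly one of the summands of \<open>controlled_norm\<close>. The sum of the products is at most
  the product of the sums, with constant 1. All seminorms are finite (the supremum norms since the
  time interval is compact), so the computation is one in the real numbers.\<close>

lemma
  shows decomposition: "J_decompositions \<alpha> V \<theta> I (germ X XX Xr y y' yr) \<noteq> {}"
    and J_norm_germ_le: "J_norm \<alpha> V \<theta> I (germ X XX Xr y y' yr)
     \<le> rho \<alpha> r I X XX Xr * (\<Sum>i\<in>UNIV. controlled_norm \<alpha> r V \<theta> I X (y i) (y' i) (yr i))"
proof -
  let ?R = "\<lambda>i. remainder r X (y i) (y' i) (yr i)"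
  let ?U = "V (\<theta> - 2 * \<alpha>)"
  define a1 a2 a3 where "a1 = enn2real (hnorm2 \<alpha> D euclidean_nspace (delta1 X))"
    and "a2 = enn2real (hnorm2 (2 * \<alpha>) D euclidean_nspace XX)"
    and "a3 = enn2real (hnorm2 (2 * \<alpha>) I euclidean_nspace Xr)"
  define Y R where "Y i = enn2real (sup_norm I (V \<theta>) (y i))"
    and "R i = enn2real (hnorm2 (2 * \<alpha>) I ?U (?R i))" for i
  define Y' Yr H' Hr where "Y' i j = enn2real (sup_norm I (V (\<theta> - \<alpha>)) (y' i j))"
    and "Yr i j = enn2real (sup_norm I (V (\<theta> - \<alpha>)) (yr i j))"
    and "H' i j = enn2real (hnorm2 \<alpha> I ?U (delta1 (y' i j)))"
    and "Hr i j = enn2real (hnorm2 \<alpha> I ?U (delta1 (yr i j)))" for i j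
  note defs = a1_def a2_def a3_def Y_def R_def Y'_def Yr_def H'_def Hr_def
  have nn: "0 \<le> a1" "0 \<le> a2" "0 \<le> a3" "\<And>i. 0 \<le> Y i" "\<And>i. 0 \<le> R i" "\<And>i j. 0 \<le> Y' i j"
      "\<And>i j. 0 \<le> Yr i j" "\<And>i j. 0 \<le> H' i j" "\<And>i j. 0 \<le> Hr i j"
    by (simp_all add: defs)
  have enn: "hnorm2 \<alpha> D euclidean_nspace (delta1 X) = ennreal a1"
    "hnorm2 (2 * \<alpha>) D euclidean_nspace XX = ennreal a2"
    "hnorm2 (2 * \<alpha>) I euclidean_nspace Xr = ennreal a3"
    "\<And>i. sup_norm I (V \<theta>) (y i) = ennreal (Y i)"
    "\<And>i. hnorm2 (2 * \<alpha>) I ?U (?R i) = ennreal (R i)"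
    "\<And>i j. sup_norm I (V (\<theta> - \<alpha>)) (y' i j) = ennreal (Y' i j)"
    "\<And>i j. sup_norm I (V (\<theta> - \<alpha>)) (yr i j) = ennreal (Yr i j)"
    "\<And>i j. hnorm2 \<alpha> I ?U (delta1 (y' i j)) = ennreal (H' i j)"
    "\<And>i j. hnorm2 \<alpha> I ?U (delta1 (yr i j)) = ennreal (Hr i j)"
    using X_hnorm_finite y_C1 sp.sup_norm_finite[OF y_C1(1)] sp.sup_norm_finite[OF y_C1(2)]
      sp.sup_norm_finite[OF y_C1(3)] unfolding defs by simp_all
  have dX: "\<bar>delta1 X v u $ i\<bar> \<le> a1 * (v - u) powr \<alpha>"
    and dXX: "\<bar>XX v u $ i $ j\<bar> \<le> a2 * (v - u) powr (2 * \<alpha>)"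
    and dXr: "\<bar>Xr v u $ i $ j\<bar> \<le> a3 * (v - u) powr (2 * \<alpha>)"
    if "u \<in> I" "v \<in> I" "u < v" for v u i j
  proof -
    have D: "u \<in> D" "v \<in> D" using that I_subset_D by auto
    show "\<bar>delta1 X v u $ i\<bar> \<le> a1 * (v - u) powr \<alpha>"
      using hnorm2_leD[OF enn(1)[THEN eq_refl] nn(1) D that(3)] component_le_norm_cart[of "delta1 X v u" i]
      by simp
    show "\<bar>XX v u $ i $ j\<bar> \<le> a2 * (v - u) powr (2 * \<alpha>)"
      using hnorm2_leD[OF enn(2)[THEN eq_refl] nn(2) D that(3)] matrix_component_le_norm[of "XX v u" i j]
      by simp
    show "\<bar>Xr v u $ i $ j\<bar> \<le> a3 * (v - u) powr (2 * \<alpha>)"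
      using hnorm2_leD[OF enn(3)[THEN eq_refl] nn(3) that] matrix_component_le_norm[of "Xr v u" i j]
      by simp
  qed
  have 1: "hnorm2 \<alpha> I (V \<theta>) f1 \<le> ennreal (a1 * (\<Sum>i\<in>UNIV. Y i))"
  proof (rule hnorm2_leI)
    fix u v assume uv: "u \<in> I" "v \<in> I" "u < v"
    have "nrm (V \<theta>) (f1 v u) \<le> a1 * (v - u) powr \<alpha> * (\<Sum>i\<in>UNIV. Y i)"
      unfolding f1_def using nn
      by (intro sp.nrm_sum_scaleR_le sp.C1_car[OF y_C1(1)] dX uv
          sup_norm_leD[OF enn(4)[THEN eq_refl]]) auto
    then show "nrm (V \<theta>) (f1 v u) \<le> a1 * (\<Sum>i\<in>UNIV. Y i) * (v - u) powr \<alpha>"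
      by (simp add: mult_ac)
  qed
  have 2: "hnorm2 (2 * \<alpha>) I (V (\<theta> - \<alpha>)) f2
      \<le> ennreal (a2 * (\<Sum>i\<in>UNIV. \<Sum>j\<in>UNIV. Y' i j) + a3 * (\<Sum>i\<in>UNIV. \<Sum>j\<in>UNIV. Yr i j))"
  proof (rule hnorm2_leI)
    fix u v assume uv: "u \<in> I" "v \<in> I" "u < v"
    let ?p = "(v - u) powr (2 * \<alpha>)"
    have "nrm (V (\<theta> - \<alpha>)) (\<Sum>i\<in>UNIV. \<Sum>j\<in>UNIV. (XX v u $ j $ i) *\<^sub>R y' i j u)
        \<le> a2 * ?p * (\<Sum>i\<in>UNIV. \<Sum>j\<in>UNIV. Y' i j)"
      using nn by (intro sp.nrm_sum2_scaleR_le sp.C1_car[OF y_C1(2)] dXX uv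
          sup_norm_leD[OF enn(6)[THEN eq_refl]]) auto
    moreover have "nrm (V (\<theta> - \<alpha>)) (\<Sum>i\<in>UNIV. \<Sum>j\<in>UNIV. (Xr v u $ j $ i) *\<^sub>R yr i j u)
        \<le> a3 * ?p * (\<Sum>i\<in>UNIV. \<Sum>j\<in>UNIV. Yr i j)"
      using nn by (intro sp.nrm_sum2_scaleR_le sp.C1_car[OF y_C1(3)] dXr uv
          sup_norm_leD[OF enn(7)[THEN eq_refl]]) auto
    ultimately have "nrm (V (\<theta> - \<alpha>)) (f2 v u)
        \<le> a2 * ?p * (\<Sum>i\<in>UNIV. \<Sum>j\<in>UNIV. Y' i j) + a3 * ?p * (\<Sum>i\<in>UNIV. \<Sum>j\<in>UNIV. Yr i j)"
      unfolding f2_def using uv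
      by (intro order_trans[OF sp.nrm_triangle] add_mono sp.sum_car sp.scaleR_car
          sp.C1_car[OF y_C1(2)] sp.C1_car[OF y_C1(3)])
    then show "nrm (V (\<theta> - \<alpha>)) (f2 v u) \<le> (a2 * (\<Sum>i\<in>UNIV. \<Sum>j\<in>UNIV. Y' i j)
        + a3 * (\<Sum>i\<in>UNIV. \<Sum>j\<in>UNIV. Yr i j)) * ?p"
      by (simp add: algebra_simps)
  qed
  have 3: "hnorm3 (2 * \<alpha>) \<alpha> I ?U f3 \<le> ennreal (a1 * (\<Sum>i\<in>UNIV. R i))"
  proof (rule hnorm3_leI)
    fix u m v assume u: "u \<in> I" "m \<in> I" "v \<in> I" "u < m" "m < v"
    let ?q = "(m - u) powr (2 * \<alpha>)"
    have car: "?R i m u \<in> car ?U" for i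
      using u by (intro sp.C2_car[OF y_C1(8)]) auto
    have "nrm ?U (\<Sum>i\<in>UNIV. (delta1 X v m $ i) *\<^sub>R ?R i m u)
        \<le> a1 * (v - m) powr \<alpha> * (\<Sum>i\<in>UNIV. R i * ?q)"
      using nn by (intro sp.nrm_sum_scaleR_le car dX u hnorm2_leD[OF enn(5)[THEN eq_refl]]) auto
    moreover have "nrm ?U (f3 v m u) = nrm ?U (\<Sum>i\<in>UNIV. (delta1 X v m $ i) *\<^sub>R ?R i m u)"
      unfolding f3_def by (intro sp.nrm_uminus sp.sum_car sp.scaleR_car car)
    ultimately show "nrm ?U (f3 v m u) \<le> a1 * (\<Sum>i\<in>UNIV. R i) * (?q * (v - m) powr \<alpha>)"
      by (simp add: sum_distrib_right[symmetric] mult_ac)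
  qed
  have 4: "hnorm3 \<alpha> (2 * \<alpha>) I ?U f4
      \<le> ennreal (a2 * (\<Sum>i\<in>UNIV. \<Sum>j\<in>UNIV. H' i j) + a3 * (\<Sum>i\<in>UNIV. \<Sum>j\<in>UNIV. Hr i j))"
  proof (rule hnorm3_leI)
    fix u m v assume u: "u \<in> I" "m \<in> I" "v \<in> I" "u < m" "m < v"
    let ?p = "(v - m) powr (2 * \<alpha>)" and ?q = "(m - u) powr \<alpha>"
    have car: "delta1 (y' i j) m u \<in> car ?U" "delta1 (yr i j) m u \<in> car ?U" for i j
      unfolding delta1_def using u
      by (intro sp.diff_car sp.C1_car[OF y_C1(4)] sp.C1_car[OF y_C1(5)]; simp)+
    have A: "nrm ?U (\<Sum>i\<in>UNIV. \<Sum>j\<in>UNIV. (XX v m $ j $ i) *\<^sub>R delta1 (y' i j) m u)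
        \<le> a2 * ?p * (\<Sum>i\<in>UNIV. \<Sum>j\<in>UNIV. H' i j * ?q)"
      using nn by (intro sp.nrm_sum2_scaleR_le car dXX u hnorm2_leD[OF enn(8)[THEN eq_refl]]) auto
    have B: "nrm ?U (\<Sum>i\<in>UNIV. \<Sum>j\<in>UNIV. (Xr v m $ j $ i) *\<^sub>R delta1 (yr i j) m u)
        \<le> a3 * ?p * (\<Sum>i\<in>UNIV. \<Sum>j\<in>UNIV. Hr i j * ?q)"
      using nn by (intro sp.nrm_sum2_scaleR_le car dXr u hnorm2_leD[OF enn(9)[THEN eq_refl]]) auto
    have "nrm ?U (f4 v m u) \<le> a2 * ?p * (\<Sum>i\<in>UNIV. \<Sum>j\<in>UNIV. H' i j * ?q)
        + a3 * ?p * (\<Sum>i\<in>UNIV. \<Sum>j\<in>UNIV. Hr i j * ?q)"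
      unfolding f4_def using A B
      by (subst sp.nrm_uminus; intro sp.add_car order_trans[OF sp.nrm_triangle] add_mono
          sp.sum_car sp.scaleR_car car)
    then show "nrm ?U (f4 v m u) \<le> (a2 * (\<Sum>i\<in>UNIV. \<Sum>j\<in>UNIV. H' i j)
        + a3 * (\<Sum>i\<in>UNIV. \<Sum>j\<in>UNIV. Hr i j)) * (?q * ?p)"
      by (simp add: sum_distrib_right[symmetric] algebra_simps)
  qed
  have finite: "x < \<infinity>" if "x \<le> ennreal c" for x c
    using that by (simp add: order_le_less_trans)
  have dec: "(f1, f2, f3, f4) \<in> J_decompositions \<alpha> V \<theta> I (germ X XX Xr y y' yr)"
    unfolding J_decompositions_def C2_hoelder_def C3_hoelder_def
    using continuous_f 1[THEN finite] 2[THEN finite] 3[THEN finite] 4[THEN finite] germ_eq delta2_germ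
    by auto
  then show "J_decompositions \<alpha> V \<theta> I (germ X XX Xr y y' yr) \<noteq> {}" by blast
  have "J_norm \<alpha> V \<theta> I (germ X XX Xr y y' yr)
      \<le> hnorm2 \<alpha> I (V \<theta>) f1 + hnorm2 (2 * \<alpha>) I (V (\<theta> - \<alpha>)) f2
        + hnorm3 (2 * \<alpha>) \<alpha> I ?U f3 + hnorm3 \<alpha> (2 * \<alpha>) I ?U f4"
    unfolding J_norm_def by (rule INF_lower2[OF dec]) simp
  also have "\<dots> \<le> ennreal (a1 * (\<Sum>i\<in>UNIV. Y i))
      + ennreal (a2 * (\<Sum>i\<in>UNIV. \<Sum>j\<in>UNIV. Y' i j) + a3 * (\<Sum>i\<in>UNIV. \<Sum>j\<in>UNIV. Yr i j))
      + ennreal (a1 * (\<Sum>i\<in>UNIV. R i))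
      + ennreal (a2 * (\<Sum>i\<in>UNIV. \<Sum>j\<in>UNIV. H' i j) + a3 * (\<Sum>i\<in>UNIV. \<Sum>j\<in>UNIV. Hr i j))"
    by (intro add_mono 1 2 3 4)
  also have "\<dots> = ennreal (a1 * ((\<Sum>i\<in>UNIV. Y i) + (\<Sum>i\<in>UNIV. R i))
      + a2 * ((\<Sum>i\<in>UNIV. \<Sum>j\<in>UNIV. Y' i j) + (\<Sum>i\<in>UNIV. \<Sum>j\<in>UNIV. H' i j))
      + a3 * ((\<Sum>i\<in>UNIV. \<Sum>j\<in>UNIV. Yr i j) + (\<Sum>i\<in>UNIV. \<Sum>j\<in>UNIV. Hr i j)))"
    using nn by (simp add: sum_nonneg algebra_simps flip: ennreal_plus)
  also have "\<dots> \<le> ennreal ((a1 + a2 + a3) * (\<Sum>i\<in>UNIV. Y i + (\<Sum>j\<in>UNIV. Y' i j) + (\<Sum>j\<in>UNIV. H' i j)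
      + (\<Sum>j\<in>UNIV. Yr i j) + (\<Sum>j\<in>UNIV. Hr i j) + R i))" (is "_ \<le> ennreal (_ * ?S)")
    unfolding distrib_right using nn
    by (intro ennreal_leI add_mono mult_left_mono) (simp_all add: sum.distrib sum_nonneg)
  also have "\<dots> = rho \<alpha> r I X XX Xr * ennreal ?S"
    unfolding rho_def enn using nn by (simp add: ennreal_mult sum_nonneg)
  also have "ennreal ?S \<le> (\<Sum>i\<in>UNIV. controlled_norm \<alpha> r V \<theta> I X (y i) (y' i) (yr i))"
  proof -
    have "ennreal (Y i + (\<Sum>j\<in>UNIV. Y' i j) + (\<Sum>j\<in>UNIV. H' i j)
      + (\<Sum>j\<in>UNIV. Yr i j) + (\<Sum>j\<in>UNIV. Hr i j) + R i) \<le> controlled_norm \<alpha> r V \<theta> I X (y i) (y' i) (yr i)" for i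
    proof -
      have "ennreal (Y i + (\<Sum>j\<in>UNIV. Y' i j) + (\<Sum>j\<in>UNIV. H' i j)
          + (\<Sum>j\<in>UNIV. Yr i j) + (\<Sum>j\<in>UNIV. Hr i j) + R i)
        = ennreal (Y i) + (\<Sum>j\<in>UNIV. ennreal (Y' i j)) + (\<Sum>j\<in>UNIV. ennreal (H' i j))
          + (\<Sum>j\<in>UNIV. ennreal (Yr i j)) + (\<Sum>j\<in>UNIV. ennreal (Hr i j)) + ennreal (R i)"
        using nn by (simp add: sum_nonneg)
      also have "\<dots> \<le> controlled_norm \<alpha> r V \<theta> I X (y i) (y' i) (yr i)"
        unfolding controlled_norm_def enn(4-9)[symmetric] hnorm1_def
        by (rule add_mono[OF add_increasing2 order_refl], simp,
            intro add_mono sum_mono order_refl add_increasing) simp_all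
      finally show ?thesis .
    qed
    then show ?thesis
      using nn by (subst sum_ennreal[symmetric]) (auto intro!: sum_mono add_nonneg_nonneg sum_nonneg)
  qed
  finally show "J_norm \<alpha> V \<theta> I (germ X XX Xr y y' yr)
      \<le> rho \<alpha> r I X XX Xr * (\<Sum>i\<in>UNIV. controlled_norm \<alpha> r V \<theta> I X (y i) (y' i) (yr i))"
    by (simp add: mult_left_mono)
qed

end


section \<open>Existence and estimate of the rough convolution\<close>

theorem lemma3p5:
  fixes V :: "real \<Rightarrow> 'a::real_vector nspace" and B :: "'a nspace" and S :: "real \<Rightarrow> 'a \<Rightarrow> 'a"
    and \<alpha> \<theta> r T :: real
  assumes "smoothing_semigroup V B S"
    and "1/3 < \<alpha>" and "\<alpha> \<le> 1/2" and "0 < r" and "0 \<le> T"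
  shows
    "(\<forall>(X :: real \<Rightarrow> real ^ 'd) XX Xr y y' yr.
        delayed_rough_path \<alpha> r {0..T} X XX Xr \<and>
        (\<forall>i. delayed_controlled_path \<alpha> r V \<theta> {0..T} X (y i) (y' i) (yr i)) \<longrightarrow>
        (\<forall>t\<in>{0..T}. \<exists>z\<in>car (V (\<theta> - 2 * \<alpha>)).
           has_rough_convolution (V (\<theta> - 2 * \<alpha>)) S (germ X XX Xr y y' yr) 0 t z))
   \<and> (\<forall>\<beta>. 0 \<le> \<beta> \<and> \<beta> < 3 * \<alpha> \<longrightarrow>
        (\<exists>C1 C2. \<forall>(X :: real \<Rightarrow> real ^ 'd) XX Xr y y' yr s t.
           delayed_rough_path \<alpha> r {0..T} X XX Xr \<and>
           (\<forall>i. delayed_controlled_path \<alpha> r V \<theta> {0..T} X (y i) (y' i) (yr i)) \<and>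
           0 \<le> s \<and> s \<le> t \<and> t \<le> T \<longrightarrow>
           (\<exists>z. has_rough_convolution (V (\<theta> - 2 * \<alpha>)) S (germ X XX Xr y y' yr) s t z) \<and>
           rough_convolution (V (\<theta> - 2 * \<alpha>)) S (germ X XX Xr y y' yr) s t
             - S (t - s) (germ X XX Xr y y' yr t s) \<in> car (V (\<theta> - 2 * \<alpha> + \<beta>)) \<and>
           ennreal (nrm (V (\<theta> - 2 * \<alpha> + \<beta>))
               (rough_convolution (V (\<theta> - 2 * \<alpha>)) S (germ X XX Xr y y' yr) s t
                  - S (t - s) (germ X XX Xr y y' yr t s)))
             \<le> ennreal C1 * J_norm \<alpha> V \<theta> {0..T} (germ X XX Xr y y' yr)
                 * ennreal ((t - s) powr (3 * \<alpha> - \<beta>)) \<and>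
           J_norm \<alpha> V \<theta> {0..T} (germ X XX Xr y y' yr)
               * ennreal ((t - s) powr (3 * \<alpha> - \<beta>))
             \<le> ennreal C2 * rho \<alpha> r {0..T} X XX Xr
                 * (\<Sum>i\<in>UNIV. controlled_norm \<alpha> r V \<theta> {0..T} X (y i) (y' i) (yr i))
                 * ennreal ((t - s) powr (3 * \<alpha> - \<beta>))))"
proof -
  interpret smoothing_semigroup V B S by (rule assms(1))
  let ?W = "V (\<theta> - 2 * \<alpha>)"
  show ?thesis (is "_ \<and> (\<forall>\<beta>. _ \<longrightarrow> ?claim \<beta>)")
  proof (intro conjI allI impI ballI; (elim conjE)?)
    fix X :: "real \<Rightarrow> real ^ 'd" and XX Xr t and y :: "'d \<Rightarrow> real \<Rightarrow> 'a" and y' yr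
    assume "delayed_rough_path \<alpha> r {0..T} X XX Xr"
      and "\<forall>i. delayed_controlled_path \<alpha> r V \<theta> {0..T} X (y i) (y' i) (yr i)"
    then interpret G: delayed_germ V \<alpha> \<theta> r T X XX Xr y y' yr
      using assms(2) by unfold_locales auto
    assume t: "t \<in> {0..T}"
    have "0 < 3 * \<alpha>" using assms(2) by simp
    then have "\<exists>z. has_rough_convolution ?W S (germ X XX Xr y y' yr) 0 t z"
      using rough_convolution_J_norm[OF assms(2,3) order_refl] G.germ_diagonal G.decomposition t
      by (metis atLeastAtMost_iff order_refl)
    then show "\<exists>z\<in>car ?W. has_rough_convolution ?W S (germ X XX Xr y y' yr) 0 t z"
      unfolding has_rough_convolution_def by (auto simp: sp.limitin_iff)
  next
    fix \<beta> assume \<beta>: "0 \<le> \<beta>" "\<beta> < 3 * \<alpha>"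
    obtain C where C: "\<And>f s t. (\<And>u. 0 \<le> u \<Longrightarrow> u \<le> T \<Longrightarrow> f u u = 0) \<Longrightarrow>
        J_decompositions \<alpha> V \<theta> {0..T} f \<noteq> {} \<Longrightarrow> 0 \<le> s \<Longrightarrow> s \<le> t \<Longrightarrow> t \<le> T \<Longrightarrow>
        has_rough_convolution ?W S f s t (rough_convolution ?W S f s t) \<and>
        rough_convolution ?W S f s t - S (t - s) (f t s) \<in> car (V (\<theta> - 2 * \<alpha> + \<beta>)) \<and>
        ennreal (nrm (V (\<theta> - 2 * \<alpha> + \<beta>)) (rough_convolution ?W S f s t - S (t - s) (f t s)))
          \<le> ennreal C * J_norm \<alpha> V \<theta> {0..T} f * ennreal ((t - s) powr (3 * \<alpha> - \<beta>))"
      using rough_convolution_J_norm[OF assms(2,3) \<beta>, of T \<theta>] by blast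
    show "?claim \<beta>"
    proof (rule exI[of _ C], rule exI[of _ 1], intro allI impI, elim conjE)
      fix X :: "real \<Rightarrow> real ^ 'd" and XX Xr s t and y :: "'d \<Rightarrow> real \<Rightarrow> 'a" and y' yr
      let ?f = "germ X XX Xr y y' yr"
      let ?z = "rough_convolution ?W S ?f s t"
      assume "delayed_rough_path \<alpha> r {0..T} X XX Xr"
        and "\<forall>i. delayed_controlled_path \<alpha> r V \<theta> {0..T} X (y i) (y' i) (yr i)"
      then interpret G: delayed_germ V \<alpha> \<theta> r T X XX Xr y y' yr
        using assms(2) by unfold_locales auto
      assume st: "0 \<le> s" "s \<le> t" "t \<le> T"
      have 1: "has_rough_convolution ?W S ?f s t ?z"
          "?z - S (t - s) (?f t s) \<in> car (V (\<theta> - 2 * \<alpha> + \<beta>))"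
          "ennreal (nrm (V (\<theta> - 2 * \<alpha> + \<beta>)) (?z - S (t - s) (?f t s)))
            \<le> ennreal C * J_norm \<alpha> V \<theta> {0..T} ?f * ennreal ((t - s) powr (3 * \<alpha> - \<beta>))"
        using C[of ?f s t] G.germ_diagonal G.decomposition st by auto
      have 2: "J_norm \<alpha> V \<theta> {0..T} ?f * ennreal ((t - s) powr (3 * \<alpha> - \<beta>))
          \<le> ennreal 1 * rho \<alpha> r {0..T} X XX Xr
              * (\<Sum>i\<in>UNIV. controlled_norm \<alpha> r V \<theta> {0..T} X (y i) (y' i) (yr i))
              * ennreal ((t - s) powr (3 * \<alpha> - \<beta>))"
        unfolding ennreal_1 mult_1 by (intro mult_right_mono G.J_norm_germ_le) simp
      show "(\<exists>z. has_rough_convolution ?W S ?f s t z) \<and>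
          ?z - S (t - s) (?f t s) \<in> car (V (\<theta> - 2 * \<alpha> + \<beta>)) \<and>
          ennreal (nrm (V (\<theta> - 2 * \<alpha> + \<beta>)) (?z - S (t - s) (?f t s)))
            \<le> ennreal C * J_norm \<alpha> V \<theta> {0..T} ?f * ennreal ((t - s) powr (3 * \<alpha> - \<beta>)) \<and>
          J_norm \<alpha> V \<theta> {0..T} ?f * ennreal ((t - s) powr (3 * \<alpha> - \<beta>))
            \<le> ennreal 1 * rho \<alpha> r {0..T} X XX Xr
              * (\<Sum>i\<in>UNIV. controlled_norm \<alpha> r V \<theta> {0..T} X (y i) (y' i) (yr i))
              * ennreal ((t - s) powr (3 * \<alpha> - \<beta>))"
        using 1 2 by blast
    qed
  qed
qed

end
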